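(* Let $F$ be an algebraically closed field of characteristic $\neq 2$, $R=F[t]$ with the involution ${}^*$ described in the context. Let $A,A'\in M_n(R)$ be both hermitian or both skew-hermitian. If $A$ and $A'$ are equivalent (i.e. $A'=SAT$ for some $S,T\in\mathrm{GL}_n(R)$, equivalently they have the same invariant factors), then $A$ and $A'$ are congruent.
   Context: $R=F[t]$ is the polynomial ring over $F$, and ${}^*$ is the $F$-algebra involution of $R$ that is the identity on $F$ and sends $t$ to $-t$. For $A=(a_{ij})\in M_n(R)$, $A^*$ is the matrix whose $(i,j)$ entry is $a_{ji}^*$. $A$ is hermitian if $A^*=A$ and skew-hermitian if $A^*=-A$. Two such matrices $A,B$ are congruent if $B=S^*AS$ for some $S\in\mathrm{GL}_n(R)$. *)

theory Defs
  imports "HOL-Analysis.Analysis" "HOL-Computational_Algebra.Polynomial"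
begin

definition alg_closed_field :: "('a::field) itself \<Rightarrow> bool" where
  "alg_closed_field _ \<longleftrightarrow> (\<forall>p::'a poly. degree p \<ge> 1 \<longrightarrow> (\<exists>x. poly p x = 0))"

definition pstar :: "'a::comm_ring_1 poly \<Rightarrow> 'a poly" where
  "pstar p = pcompose p [:0, -1:]"

definition mstar :: "'a::comm_ring_1 poly ^'n^'n \<Rightarrow> 'a poly ^'n^'n" where
  "mstar A = (\<chi> i j. pstar (A $ j $ i))"

definition hermitian :: "'a::comm_ring_1 poly ^'n^'n \<Rightarrow> bool" where
  "hermitian A \<longleftrightarrow> mstar A = A"

definition skew_hermitian :: "'a::comm_ring_1 poly ^'n^'n \<Rightarrow> bool" where
  "skew_hermitian A \<longleftrightarrow> mstar A = - A"

definition mat_equivalent :: "'a::comm_ring_1 poly ^'n^'n \<Rightarrow> 'a poly ^'n^'n \<Rightarrow> bool" where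
  "mat_equivalent A B \<longleftrightarrow> (\<exists>S T. invertible S \<and> invertible T \<and> B = S ** A ** T)"

definition mat_congruent :: "'a::comm_ring_1 poly ^'n^'n \<Rightarrow> 'a poly ^'n^'n \<Rightarrow> bool" where
  "mat_congruent A B \<longleftrightarrow> (\<exists>S. invertible S \<and> B = mstar S ** A ** S)"

end

theory Submission
  imports Defs
begin

text \<open>Multiplication by \<open>t\<close> reduces the skew-hermitian case to the hermitian one. Since \<open>F\<close> is algebraically
  closed, every even polynomial is a norm \<open>x x\<^sup>\<star>\<close>. Hence every hermitian plane is isotropic, and
  a hermitian form whose coefficients have greatest common divisor \<open>1\<close> represents \<open>1\<close>, while a
  skew-hermitian one represents \<open>t\<close>. Let \<open>d\<close> be the content of a hermitian matrix. If \<open>d\<close> is even,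
  a vector of value \<open>d\<close> spans an orthogonal summand. If \<open>d\<close> is odd, divide by \<open>d\<close> and choose a vector
  of value \<open>t\<close>; the hermitian form \<open>t h(x, y) - h(x, e) h(e, y)\<close> which it induces has even content,
  and a second vector representing this content completes the first one to a plane which is a summand.
  Normalising the plane shows that the matrix is congruent to a block matrix determined by the
  invariant factors, and equivalent matrices have the same invariant factors.\<close>

section \<open>Even polynomials as norms\<close>

text \<open>The obstacle is an odd content. Dividing by it leaves a skew-hermitian form, whose
  values h(x, x) are all odd and hence multiples of t, so 1 is never attained. A vector e of value t
  is the best substitute, but t is not a unit and e alone need not split off, so a plane is needed.
  Its Gram matrix, with rows (t, 1) and (-1, c), has determinant f = t c + 1. The constant term 1
  lets f, known up to a scalar from the invariant factors, be recovered exactly, and c with it; it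
  also allows t to be cancelled modulo f. The induced form has even content because the involution
  is trivial at t = 0: there -h(y, e) h(e, y) is a square, nonzero for a suitable y, whereas an odd
  content would vanish. Characteristic different from 2 enters through averaging with the conjugate
  and through the vanishing of odd polynomials at 0.\<close>

notation pstar ("_\<^sup>\<star>" [1000] 999)

definition tvar :: "'a::comm_ring_1 poly" where "tvar = [:0, 1:]"

lemma pstar_add [simp]: "(p + q)\<^sup>\<star> = p\<^sup>\<star> + q\<^sup>\<star>"
  and pstar_diff [simp]: "(p - q)\<^sup>\<star> = p\<^sup>\<star> - q\<^sup>\<star>"
  and pstar_uminus [simp]: "(- p)\<^sup>\<star> = - p\<^sup>\<star>"
  and pstar_mult [simp]: "(p * q)\<^sup>\<star> = p\<^sup>\<star> * q\<^sup>\<star>"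
  and pstar_0 [simp]: "0\<^sup>\<star> = 0"
  and pstar_1 [simp]: "1\<^sup>\<star> = 1"
  and pstar_const [simp]: "[:c:]\<^sup>\<star> = [:c:]"
  and pstar_smult [simp]: "(smult c p)\<^sup>\<star> = smult c (p\<^sup>\<star>)"
  by (simp_all add: pstar_def pcompose_add pcompose_diff pcompose_uminus pcompose_mult pcompose_smult pcompose_1)

lemma pstar_sum [simp]: "(sum f A)\<^sup>\<star> = (\<Sum>i\<in>A. (f i)\<^sup>\<star>)"
  by (induction A rule: infinite_finite_induct) auto

lemma pstar_pstar [simp]: "(p\<^sup>\<star>)\<^sup>\<star> = p"
proof -
  have "pcompose [:0, -1:] [:0, -1:] = [:0, 1 :: 'a:]" by (simp add: pcompose_pCons)
  then show ?thesis by (simp add: pstar_def flip: pcompose_assoc)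
qed

lemma pstar_eq_0_iff [simp]: "p\<^sup>\<star> = 0 \<longleftrightarrow> p = 0"
  by (metis pstar_0 pstar_pstar)

lemma poly_pstar [simp]: "poly (p\<^sup>\<star>) x = poly p (- x)"
  by (simp add: pstar_def poly_pcompose)

lemma degree_pstar [simp]: "degree (p\<^sup>\<star>) = degree (p :: 'a::idom poly)"
  by (simp add: pstar_def degree_pcompose)

lemma pstar_tvar [simp]: "tvar\<^sup>\<star> = - tvar"
  by (simp add: tvar_def pstar_def pcompose_pCons)

lemma poly_tvar [simp]: "poly tvar x = x"
  by (simp add: tvar_def)

lemma tvar_neq_0 [simp]: "tvar \<noteq> 0"
  by (simp add: tvar_def)

lemma degree_tvar [simp]: "degree (tvar :: 'a::comm_ring_1 poly) = 1"
  by (simp add: tvar_def)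

lemma tvar_dvd_iff: "tvar dvd p \<longleftrightarrow> poly p 0 = (0 :: 'a::comm_ring_1)"
  using poly_eq_0_iff_dvd[of p 0] by (simp add: tvar_def)

lemma const_plus_tvar_mult: obtains m where "p = [:poly p 0:] + tvar * (m :: 'a::comm_ring_1 poly)"
proof -
  have "tvar dvd p - [:poly p 0:]" by (simp add: tvar_dvd_iff)
  then show ?thesis by (metis that diff_add_cancel add.commute dvdE)
qed

text \<open>A polynomial with nonzero constant term is prime to \<open>tvar\<close>. In
  \<open>skew_clear\<close> divisibility becomes visible only after multiplication by
  \<open>tvar\<close>.\<close>

lemma dvd_tvar_mult_cancel:
  fixes k z :: "'a::idom poly"
  assumes "k dvd tvar * z" "poly k 0 \<noteq> 0"
  shows "k dvd z"
proof -
  obtain m where m: "tvar * z = k * m" using assms(1) by (auto simp: dvd_def)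
  then have "poly (k * m) 0 = 0" by (metis mult_zero_left poly_mult poly_tvar)
  with assms(2) have "tvar dvd m" by (simp add: tvar_dvd_iff)
  then obtain m' where "m = tvar * m'" by (auto simp: dvd_def)
  with m have "tvar * z = tvar * (k * m')" by (simp add: algebra_simps)
  then show ?thesis by simp
qed

text \<open>A nonzero combination of least degree divides every combination, since a remainder would
  be a combination of smaller degree.\<close>

lemma poly_bezout:
  fixes p q :: "'a::field poly"
  obtains a b where "a * p + b * q dvd p" "a * p + b * q dvd q"
proof (cases "p = 0 \<and> q = 0")
  case True
  then show ?thesis using that by simp
next
  case False
  define S where "S = {a * p + b * q | a b. a * p + b * q \<noteq> 0}"
  have "p \<in> S \<or> q \<in> S" using False unfolding S_def
    by (smt (verit, ccfv_threshold) add.commute add.right_neutral mem_Collect_eq mult_1 mult_zero_left)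
  then obtain g where g: "g \<in> S" "\<And>g'. g' \<in> S \<Longrightarrow> degree g \<le> degree g'"
    using ex_has_least_nat[of "\<lambda>x. x \<in> S" _ degree] by blast
  then obtain a b where ab: "g = a * p + b * q" "g \<noteq> 0" by (auto simp: S_def)
  have "g dvd c * p + d * q" for c d
  proof (rule ccontr)
    assume n: "\<not> g dvd c * p + d * q"
    let ?r = "(c * p + d * q) mod g"
    have "?r = (c * p + d * q) - ((c * p + d * q) div g) * g" by (metis minus_div_mult_eq_mod)
    also have "\<dots> = (c - ((c * p + d * q) div g) * a) * p + (d - ((c * p + d * q) div g) * b) * q"
      unfolding ab(1) by (simp add: algebra_simps)
    finally have "?r \<in> S" using n unfolding S_def by (auto simp: dvd_eq_mod_eq_0)
    moreover have "degree ?r < degree g" using n ab(2) degree_mod_less by (metis dvd_eq_mod_eq_0)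
    ultimately show False using g(2) by fastforce
  qed
  from this[of 1 0] this[of 0 1] show ?thesis using that ab(1) by simp
qed

text \<open>Over an algebraically closed field: \<open>p\<close> is prime to its conjugate. The case
  x = 0 demands a nonzero constant term.\<close>

definition no_star_root :: "'a::comm_ring_1 poly \<Rightarrow> bool" where
  "no_star_root p \<longleftrightarrow> (\<forall>x. poly p x \<noteq> 0 \<or> poly p (- x) \<noteq> 0)"

locale alg_closed_char_not_2 =
  fixes ty :: "'a::field itself"
  assumes ac: "alg_closed_field TYPE('a)" and two: "(2::'a) \<noteq> 0"
begin

lemma ex_root: "degree (p :: 'a poly) \<ge> 1 \<Longrightarrow> \<exists>x. poly p x = 0"
  using ac by (auto simp: alg_closed_field_def)

lemma no_root_const: "(\<And>x. poly (p :: 'a poly) x \<noteq> 0) \<Longrightarrow> \<exists>c. c \<noteq> 0 \<and> p = [:c:]"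
  using ex_root[of p] degree_eq_zeroE[of p] by (metis One_nat_def less_one not_le poly_0 pCons_0_0)

lemma ex_sqrt: "\<exists>y::'a. y * y = c"
proof -
  obtain x where "poly [:-c, 0, 1:] x = 0" using ex_root[of "[:-c, 0, 1:]"] by auto
  then show ?thesis by (intro exI[of _ x]) (simp add: algebra_simps)
qed

text \<open>Over a finite field, 1 plus the product of all t - a would be nonconstant without
  roots.\<close>

lemma infinite_field: "infinite (UNIV :: 'a set)"
proof
  assume fin: "finite (UNIV :: 'a set)"
  let ?p = "\<Prod>a\<in>UNIV. [:-a, 1 :: 'a:]"
  have d: "degree ?p = card (UNIV :: 'a set)" 
    by (subst degree_prod_eq_sum_degree) auto
  have "card (UNIV :: 'a set) > 0" using fin by (simp add: finite_UNIV_card_ge_0)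
  with d have "degree (1 + ?p) \<ge> 1" by (subst degree_add_eq_right) auto
  then obtain x where "poly (1 + ?p) x = 0" using ex_root by blast
  moreover have "poly ?p x = 0" unfolding poly_prod by (rule prod_zero[OF fin]) (auto intro: bexI[of _ x])
  ultimately show False by simp
qed

lemma neg_eq_self: "(a :: 'a) = - a \<longleftrightarrow> a = 0"
  using two by (metis add.inverse_neutral add_eq_0_iff mult_2 mult_eq_0_iff)

lemma two_poly: "(2 :: 'a poly) \<noteq> 0"
  using two by (metis numeral_poly pCons_eq_0_iff)

lemma odd_at_0: "p\<^sup>\<star> = - p \<Longrightarrow> poly p (0::'a) = 0"
  by (metis minus_zero neg_eq_self poly_minus poly_pstar)

lemma odd_tvar: "p\<^sup>\<star> = - (p :: 'a poly) \<Longrightarrow> \<exists>q. p = tvar * q \<and> q\<^sup>\<star> = q"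
proof -
  assume a: "p\<^sup>\<star> = - p"
  then obtain q where q: "p = tvar * q" using odd_at_0 tvar_dvd_iff by (metis dvdE)
  with a have "tvar * q\<^sup>\<star> = tvar * q" by simp
  with q show ?thesis by auto
qed

lemma bezout_no_common_root:
  assumes "\<And>x. poly (p::'a poly) x \<noteq> 0 \<or> poly q x \<noteq> 0"
  obtains a b where "a * p + b * q = 1"
proof -
  obtain a b where ab: "a * p + b * q dvd p" "a * p + b * q dvd q" using poly_bezout .
  have "poly (a * p + b * q) x \<noteq> 0" for x
    using assms[of x] ab by (metis dvdE mult_zero_left poly_mult)
  then obtain c where "c \<noteq> 0" "a * p + b * q = [:c:]" using no_root_const by blast
  then have "([:inverse c:] * a) * p + ([:inverse c:] * b) * q = 1"
    by (simp add: mult.assoc one_pCons flip: distrib_left smult_add_right)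
  then show ?thesis using that by blast
qed

section \<open>Bezout identities averaged with their conjugates\<close>

definition half :: "'a poly" where "half = [:inverse 2:]"

lemma half [simp]: "half * p + half * p = p" "half\<^sup>\<star> = half" "2 * half = 1"
proof -
  show "2 * half = 1" using two by (simp add: half_def numeral_poly one_pCons)
  then show "half * p + half * p = p" by (metis mult.assoc mult.commute mult_1 mult_2)
qed (simp add: half_def)

text \<open>The mean of a Bezout identity and its conjugate is again one, and its cofactors are
  even.\<close>

lemma bezout_even:
  assumes "\<And>x. poly (p::'a poly) x \<noteq> 0 \<or> poly q x \<noteq> 0" "p\<^sup>\<star> = p" "q\<^sup>\<star> = q"
  obtains a b where "a * p + b * q = 1" "a\<^sup>\<star> = a" "b\<^sup>\<star> = b"
proof -
  obtain a b where ab: "a * p + b * q = 1" using bezout_no_common_root assms(1) by blast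
  then have "a\<^sup>\<star> * p + b\<^sup>\<star> * q = 1" using assms by (metis pstar_1 pstar_add pstar_mult)
  then have "half * (a * p + b * q) + half * (a\<^sup>\<star> * p + b\<^sup>\<star> * q) = half * 1 + half * 1"
    using ab by simp
  then have "half * (a + a\<^sup>\<star>) * p + half * (b + b\<^sup>\<star>) * q = half * 1 + half * 1"
    by (simp only: algebra_simps)
  then show ?thesis by (intro that[of "half * (a + a\<^sup>\<star>)" "half * (b + b\<^sup>\<star>)"]) (simp_all add: add.commute)
qed

text \<open>Conjugating a Bezout identity for \<open>b\<close> and \<open>b\<^sup>\<star>\<close>
  exchanges their roles, so in the mean the cofactors are conjugate. Multiplied by an even
  polynomial, this writes it as the trace of a multiple of \<open>b\<close>.\<close>

lemma trace_one:
  assumes "no_star_root (b :: 'a poly)"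
  obtains k where "k * b + k\<^sup>\<star> * b\<^sup>\<star> = 1"
proof -
  have "poly b x \<noteq> 0 \<or> poly (b\<^sup>\<star>) x \<noteq> 0" for x using assms by (simp add: no_star_root_def)
  from bezout_no_common_root[OF this] obtain a c where ac: "a * b + c * b\<^sup>\<star> = 1" by blast
  then have "a\<^sup>\<star> * b\<^sup>\<star> + c\<^sup>\<star> * b = 1" by (metis pstar_1 pstar_add pstar_mult pstar_pstar)
  with ac have "half * (a * b + c * b\<^sup>\<star>) + half * (a\<^sup>\<star> * b\<^sup>\<star> + c\<^sup>\<star> * b) = half * 1 + half * 1"
    by simp
  then have "half * (a + c\<^sup>\<star>) * b + half * (a\<^sup>\<star> + c) * b\<^sup>\<star> = half * 1 + half * 1"
    by (simp only: algebra_simps)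
  then show ?thesis by (intro that[of "half * (a + c\<^sup>\<star>)"]) simp_all
qed

section \<open>Roots in pairs c, -c\<close>

lemma linear_pstar: "[:-c, 1:]\<^sup>\<star> = - [:c, 1 :: 'a:]"
  by (simp add: pstar_def pcompose_pCons)

lemma even_factor:
  assumes "f\<^sup>\<star> = f" "poly f (c::'a) = 0"
  obtains f' where "f = [:-c, 1:] * [:-c, 1:]\<^sup>\<star> * f'" "f'\<^sup>\<star> = f'"
proof -
  let ?l = "[:-c, 1:]"
  obtain f1 where f1: "f = ?l * f1" using assms(2) by (metis poly_eq_0_iff_dvd dvdE)
  \<comment> \<open>A nonzero root c of an even polynomial brings the distinct root -c. The root 0
    is its own partner: there \<open>f1\<close> is odd and so vanishes at 0 again.\<close>
  have "poly f1 (- c) = 0"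
  proof (cases "c = 0")
    case True
    then have "f = tvar * f1" using f1 by (simp add: tvar_def)
    then have "(- tvar) * f1\<^sup>\<star> = tvar * f1" using assms(1) by (metis pstar_mult pstar_tvar)
    then have "tvar * (f1\<^sup>\<star> + f1) = 0" by (metis add.right_inverse distrib_left mult_minus_left)
    then have "f1\<^sup>\<star> = - f1" by (simp add: add_eq_0_iff2)
    then show ?thesis using odd_at_0 True by simp
  next
    case False
    have "poly f (- c) = 0" using assms by (metis poly_pstar)
    then show ?thesis using f1 False neg_eq_self[of c] by (auto simp: algebra_simps) 
  qed
  then obtain f2 where f2: "f1 = [:c, 1:] * f2" by (metis minus_minus poly_eq_0_iff_dvd dvdE)
  have e: "f = ?l * ?l\<^sup>\<star> * (- f2)" unfolding f1 f2 linear_pstar by (simp only: mult_minus_left mult_minus_right mult.assoc minus_minus)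
  have "?l * ?l\<^sup>\<star> \<noteq> 0" unfolding mult_eq_0_iff pstar_eq_0_iff by simp
  moreover have "?l * ?l\<^sup>\<star> * (- f2)\<^sup>\<star> = ?l * ?l\<^sup>\<star> * (- f2)"
    using assms(1) e by (metis mult.commute pstar_mult pstar_pstar)
  ultimately have "(- f2)\<^sup>\<star> = - f2" by (metis mult_cancel_left)
  with e show ?thesis using that by blast
qed

lemma no_star_root_linear: "c \<noteq> (0::'a) \<Longrightarrow> no_star_root [:-c, 1:]"
  unfolding no_star_root_def using neg_eq_self[of c] by (auto simp: algebra_simps)

lemma no_star_root_mult:
  assumes "no_star_root p" "no_star_root (q :: 'a poly)" "\<And>x. poly p x \<noteq> 0 \<or> poly q (- x) \<noteq> 0"
  shows "no_star_root (p * q)"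
  unfolding no_star_root_def
proof
  fix x
  show "poly (p * q) x \<noteq> 0 \<or> poly (p * q) (- x) \<noteq> 0"
    using assms(1,2)[unfolded no_star_root_def, rule_format, of x] assms(3)[of x] assms(3)[of "- x"] by auto
qed

text \<open>At each step of the factorisation the sign of the root is chosen so that no pair of opposite
  roots appears in \<open>q\<close>.\<close>

lemma even_norm:
  assumes "f\<^sup>\<star> = (f :: 'a poly)"
  shows "\<exists>q. q * q\<^sup>\<star> = f \<and> (poly f 0 \<noteq> 0 \<longrightarrow> no_star_root q)"
  using assms
proof (induction "degree f" arbitrary: f rule: less_induct)
  case less
  show ?case
  proof (cases "degree f = 0")
    case True
    then obtain c where c: "f = [:c:]" using degree_eq_zeroE by blast
    obtain y where "y * y = c" using ex_sqrt by blast
    with c show ?thesis by (intro exI[of _ "[:y:]"]) (auto simp: no_star_root_def)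
  next
    case False
    then obtain c where c: "poly f c = 0" using ex_root[of f] by auto
    then obtain f' where f': "f = [:-c, 1:] * [:-c, 1:]\<^sup>\<star> * f'" "f'\<^sup>\<star> = f'"
      using even_factor less.prems by blast
    have "f \<noteq> 0" "f' \<noteq> 0" using False f' by auto
    moreover from this have "[:-c, 1:] * [:-c, 1:]\<^sup>\<star> \<noteq> 0" using f'(1) by (metis mult_zero_left)
    ultimately have "degree f = 1 + 1 + degree f'" unfolding f'(1)
      by (subst degree_mult_eq, simp, simp, subst degree_mult_eq) (simp_all only: degree_pstar, simp_all)
    then obtain q where q: "q * q\<^sup>\<star> = f'" "poly f' 0 \<noteq> 0 \<longrightarrow> no_star_root q"
      using less.hyps[of f'] f'(2) by auto
    show ?thesis
    proof (cases "poly q (- c) = 0")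
      case False
      have "no_star_root ([:-c, 1:] * q)" if "poly f 0 \<noteq> 0"
      proof -
        have "c \<noteq> 0" "no_star_root q" using that c f'(1) q(2) by auto
        then show ?thesis using False by (intro no_star_root_mult no_star_root_linear) auto
      qed
      moreover have "([:-c, 1:] * q) * ([:-c, 1:] * q)\<^sup>\<star> = f" 
        unfolding f'(1) q(1)[symmetric] by (simp only: pstar_mult pstar_pstar mult_ac)
      ultimately show ?thesis by blast
    next
      case True
      have "no_star_root ([:-c, 1:]\<^sup>\<star> * q)" if "poly f 0 \<noteq> 0"
      proof -
        have "c \<noteq> 0" "no_star_root q" using that c f'(1) q(2) by auto
        moreover from this True have "poly q c \<noteq> 0" unfolding no_star_root_def by blast
        ultimately show ?thesis using True no_star_root_linear[of "- c"]
          by (intro no_star_root_mult) (auto simp: linear_pstar no_star_root_def add_eq_0_iff)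
      qed
      moreover have "([:-c, 1:]\<^sup>\<star> * q) * ([:-c, 1:]\<^sup>\<star> * q)\<^sup>\<star> = f" 
        unfolding f'(1) q(1)[symmetric] by (simp only: pstar_mult pstar_pstar mult_ac)
      ultimately show ?thesis by blast
    qed
  qed
qed

text \<open>A root shared by \<open>b\<close> and its conjugate is 0 or belongs to a pair c, -c. The
  matching factor, t or the norm of t - c, is odd or even, and removing it lowers the degree. The
  case \<open>b = 0\<close> is absorbed by \<open>g = 0\<close>.\<close>

lemma star_root_factor:
  "\<exists>g e. (b :: 'a poly) = g * e \<and> (g\<^sup>\<star> = g \<or> g\<^sup>\<star> = - g) \<and> no_star_root e"
proof (induction "degree b" arbitrary: b rule: less_induct)
  case less
  show ?case
  proof (cases "b = 0 \<or> no_star_root b")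
    case True
    then show ?thesis
    proof
      assume "b = 0" then show ?thesis by (intro exI[of _ 0] exI[of _ 1]) (auto simp: no_star_root_def)
    next
      assume "no_star_root b" then show ?thesis by (intro exI[of _ 1] exI[of _ b]) auto
    qed
  next
    case False
    then obtain c where c: "poly b c = 0" "poly b (- c) = 0" by (auto simp: no_star_root_def)
    have "\<exists>h b1. b = h * b1 \<and> (h\<^sup>\<star> = h \<or> h\<^sup>\<star> = - h) \<and> degree h > 0"
    proof (cases "c = 0")
      case True
      then have "tvar dvd b" using c by (simp add: tvar_dvd_iff)
      then obtain b1 where "b = tvar * b1" by (auto simp: dvd_def)
      then show ?thesis by (intro exI[of _ tvar] exI[of _ b1]) simp
    next
      case False
      obtain b1 where b1: "b = [:-c, 1:] * b1" using c(1) by (metis poly_eq_0_iff_dvd dvdE)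
      with c(2) False have "poly b1 (- c) = 0" using neg_eq_self[of c] by (auto simp: algebra_simps)
      then have "[:c, 1:] dvd b1" by (metis minus_minus poly_eq_0_iff_dvd)
      then obtain b2 where b2: "b1 = [:-c, 1:]\<^sup>\<star> * b2"
        unfolding linear_pstar by (metis dvdE minus_dvd_iff)
      show ?thesis
      proof (intro exI conjI)
        show "b = ([:-c, 1:] * [:-c, 1:]\<^sup>\<star>) * b2" using b1 b2 by (simp only: mult.assoc)
        show "([:-c, 1:] * [:-c, 1:]\<^sup>\<star>)\<^sup>\<star> = [:-c, 1:] * [:-c, 1:]\<^sup>\<star> \<or> ([:-c, 1:] * [:-c, 1:]\<^sup>\<star>)\<^sup>\<star> = - ([:-c, 1:] * [:-c, 1:]\<^sup>\<star>)"
          by (simp only: pstar_mult pstar_pstar) (simp only: mult.commute simp_thms)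
        show "degree ([:-c, 1:] * [:-c, 1:]\<^sup>\<star>) > 0"
          by (subst degree_mult_eq) auto
      qed
    qed
    then obtain h b1 where h: "b = h * b1" "h\<^sup>\<star> = h \<or> h\<^sup>\<star> = - h" "degree h > 0" by blast
    then have "degree b1 < degree b" using False by (simp add: degree_mult_eq)
    then obtain g e where "b1 = g * e" "g\<^sup>\<star> = g \<or> g\<^sup>\<star> = - g" "no_star_root e" using less.hyps by blast
    with h show ?thesis by (intro exI[of _ "h * g"] exI[of _ e]) (auto simp: mult.assoc)
  qed
qed

end

section \<open>Values of binary forms\<close>

context alg_closed_char_not_2 begin

text \<open>Each of the finitely many roots of \<open>E\<close> rules out at most one
  \<open>j\<close>, and none if \<open>G\<close> vanishes there, because then \<open>p\<close> does
  not.\<close>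

lemma ex_const_avoiding_roots:
  assumes "E \<noteq> (0::'a poly)" "\<And>x. poly p x \<noteq> 0 \<or> poly G x \<noteq> 0"
  shows "\<exists>j. \<forall>x. poly E x = 0 \<longrightarrow> poly (p + smult j G) x \<noteq> 0"
proof -
  let ?R = "{x. poly E x = 0}"
  have "finite ((\<lambda>x. - poly p x / poly G x) ` ?R)" using assms(1) poly_roots_finite by blast
  then obtain j where j: "j \<notin> (\<lambda>x. - poly p x / poly G x) ` ?R"
    using infinite_field ex_new_if_finite by blast
  have "poly (p + smult j G) x \<noteq> 0" if "poly E x = 0" for x
  proof
    assume z: "poly (p + smult j G) x = 0"
    then have "poly G x \<noteq> 0" using assms(2)[of x] by auto
    moreover have "j * poly G x = - poly p x" using z by (simp add: add_eq_0_iff)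
    ultimately have "j = - poly p x / poly G x" by (simp add: eq_divide_eq del: divide_minus_left)
    then show False using j that by blast
  qed
  then show ?thesis by blast
qed

text \<open>The hermitian or skew-hermitian plane with Gram matrix rows \<open>(0, b)\<close> and \<open>(\<sigma> b\<^sup>\<star>, \<tau> q)\<close>
  represents \<open>\<tau>\<close>: write \<open>b = g e\<close> with \<open>e\<close> prime to its conjugate, and choose \<open>Y Y\<^sup>\<star>\<close> inverse to \<open>q\<close>
  modulo \<open>g g\<^sup>\<star>\<close>. If moreover \<open>Y e\<close> is prime to its conjugate, then the traces of its multiples
  are all even polynomials, which allows \<open>X\<close> to correct the remaining multiple of \<open>g g\<^sup>\<star>\<close>.\<close>

lemma isotropic_plane_value:
  fixes b q \<sigma> \<tau> :: "'a poly"
  assumes st: "\<sigma> = 1 \<or> \<sigma> = -1" "\<tau>\<^sup>\<star> = \<sigma> * \<tau>" and q: "q\<^sup>\<star> = q"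
    and prim: "\<And>x. poly b x \<noteq> 0 \<or> poly (b\<^sup>\<star>) x \<noteq> 0 \<or> poly q x \<noteq> 0"
  shows "\<exists>X Y. X\<^sup>\<star> * Y * b + \<sigma> * X * Y\<^sup>\<star> * b\<^sup>\<star> + \<tau> * q * Y * Y\<^sup>\<star> = \<tau>"
proof -
  obtain g e where ge: "b = g * e" "g\<^sup>\<star> = g \<or> g\<^sup>\<star> = - g" and e: "no_star_root e"
    using star_root_factor by blast
  define G where "G = g * g\<^sup>\<star>"
  have G: "G\<^sup>\<star> = G" by (simp add: G_def mult.commute)
  have gq: "poly G x \<noteq> 0 \<or> poly q x \<noteq> 0" for x
  proof -
    have "poly g (- x) = poly g x \<or> poly g (- x) = - poly g x"
      using ge(2) by (metis poly_minus poly_pstar)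
    then have "poly G x = 0 \<Longrightarrow> poly g x = 0 \<and> poly g (- x) = 0" by (auto simp: G_def)
    then show ?thesis using prim[of x] ge(1) by auto
  qed
  \<comment> \<open>\<open>n0\<close> is an even inverse of \<open>q\<close> modulo
    \<open>G\<close>.\<close>
  obtain a n0 where an: "a * G + n0 * q = 1" "a\<^sup>\<star> = a" "n0\<^sup>\<star> = n0"
    using bezout_even[OF gq G q] by blast
  have n0: "poly n0 x \<noteq> 0 \<or> poly G x \<noteq> 0" for x
    using arg_cong[OF an(1), of "\<lambda>p. poly p x"] by auto
  \<comment> \<open>\<open>n0\<close> may be changed by constant multiples of \<open>G\<close>.
    Avoiding the root 0 gives a norm factor \<open>Y\<close> prime to its conjugate; avoiding the
    roots of \<open>e\<close> and its conjugate gives \<open>Y * e\<close> the same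
    property.\<close>
  have "e \<noteq> 0" using e by (auto simp: no_star_root_def)
  then have E: "tvar * (e * e\<^sup>\<star>) \<noteq> 0" by simp
  obtain j where j: "\<And>x. poly (tvar * (e * e\<^sup>\<star>)) x = 0 \<Longrightarrow> poly (n0 + smult j G) x \<noteq> 0"
    using ex_const_avoiding_roots[OF E n0] by blast
  define n where "n = n0 + smult j G"
  have n: "n\<^sup>\<star> = n" by (simp add: n_def an G)
  have "poly n 0 \<noteq> 0" using j[of 0] by (simp add: n_def)
  then obtain Y where Y: "Y * Y\<^sup>\<star> = n" "no_star_root Y" using even_norm[OF n] by blast
  have "no_star_root (Y * e)"
  proof (rule no_star_root_mult[OF Y(2) e])
    fix x
    have "poly Y x * poly Y (- x) = poly n x" using Y(1) by (metis poly_mult poly_pstar)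
    then show "poly Y x \<noteq> 0 \<or> poly e (- x) \<noteq> 0" using j[of x] by (auto simp: n_def)
  qed
  then obtain k where k: "k * (Y * e) + k\<^sup>\<star> * (Y * e)\<^sup>\<star> = 1" using trace_one by blast
  define c where "c = a - smult j q"
  have c: "c\<^sup>\<star> = c" by (simp add: c_def an q)
  have cG: "c * G = 1 - n * q"
    using an(1) by (simp add: c_def n_def algebra_simps)
  \<comment> \<open>With this choice the first two terms of the value add up to
    \<open>\<tau> * (c * G)\<close> times the trace 1, and \<open>c * G\<close> is what
    \<open>n * q\<close> lacks from 1.\<close>
  define X where "X = (\<tau> * c * g\<^sup>\<star> * k)\<^sup>\<star>"
  have ss: "\<sigma> * \<sigma> = 1" "\<sigma>\<^sup>\<star> = \<sigma>" using st by auto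
  have "X\<^sup>\<star> * Y * b = \<tau> * (c * G) * (k * (Y * e))"
    by (simp add: X_def ge G_def algebra_simps)
  moreover have "\<sigma> * X * Y\<^sup>\<star> * b\<^sup>\<star> = (\<sigma> * \<sigma>) * \<tau> * (c * G) * (k\<^sup>\<star> * (Y * e)\<^sup>\<star>)"
    by (simp add: X_def ge G_def c st(2) algebra_simps)
  moreover have "\<tau> * q * Y * Y\<^sup>\<star> = \<tau> * (n * q)" by (simp add: Y(1)[symmetric] algebra_simps)
  ultimately have "X\<^sup>\<star> * Y * b + \<sigma> * X * Y\<^sup>\<star> * b\<^sup>\<star> + \<tau> * q * Y * Y\<^sup>\<star>
      = \<tau> * (c * G) * (k * (Y * e) + k\<^sup>\<star> * (Y * e)\<^sup>\<star>) + \<tau> * (n * q)"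
    by (simp only: ss mult_1 distrib_left)
  also have "\<dots> = \<tau>" unfolding k cG by (simp add: algebra_simps)
  finally show ?thesis by blast
qed

end

text \<open>The form with Gram matrix rows (p, 1) and (\<sigma>, q), at (x, y) and (x', y'). The
  entry 1 is the content, realised as a value of two vectors.\<close>

definition plane_form :: "'a::comm_ring_1 poly \<Rightarrow> 'a poly \<Rightarrow> 'a poly \<Rightarrow> 'a poly \<Rightarrow> 'a poly \<Rightarrow> 'a poly \<Rightarrow> 'a poly \<Rightarrow> 'a poly" where
  "plane_form \<sigma> p q x y x' y' = x\<^sup>\<star> * x' * p + x\<^sup>\<star> * y' + \<sigma> * y\<^sup>\<star> * x' + y\<^sup>\<star> * y' * q"

lemma plane_form_lin:
  "plane_form \<sigma> p q (a * x1 + b * x2) (a * y1 + b * y2) (c * x3 + d * x4) (c * y3 + d * y4) =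
   a\<^sup>\<star> * c * plane_form \<sigma> p q x1 y1 x3 y3 + a\<^sup>\<star> * d * plane_form \<sigma> p q x1 y1 x4 y4 +
   b\<^sup>\<star> * c * plane_form \<sigma> p q x2 y2 x3 y3 + b\<^sup>\<star> * d * plane_form \<sigma> p q x2 y2 x4 y4"
  by (simp add: plane_form_def algebra_simps)

lemma plane_form_star:
  assumes "\<sigma> = 1 \<or> \<sigma> = -1" "p\<^sup>\<star> = \<sigma> * p" "q\<^sup>\<star> = \<sigma> * q"
  shows "(plane_form \<sigma> p q x y x' y')\<^sup>\<star> = \<sigma> * plane_form \<sigma> p q x' y' x y"
  using assms unfolding plane_form_def by (auto simp: algebra_simps)

context alg_closed_char_not_2 begin

lemma isotropic_primitive:
  assumes s: "\<sigma> = 1 \<or> \<sigma> = -1" "p\<^sup>\<star> = \<sigma> * p" "q\<^sup>\<star> = \<sigma> * (q :: 'a poly)"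
  shows "\<exists>x y a b. a * x + b * y = 1 \<and> plane_form \<sigma> p q x y x y = 0"
proof -
  have ss: "\<sigma> * \<sigma> = 1" "\<sigma>\<^sup>\<star> = \<sigma>" using s by auto
  obtain X Y where XY: "X \<noteq> 0 \<or> Y \<noteq> 0" "plane_form \<sigma> p q X Y X Y = 0"
  proof (cases "p = 0")
    case True
    then show ?thesis by (intro that[of 1 0]) (auto simp: plane_form_def)
  next
    case False
    \<comment> \<open>Completing the square: \<open>p\<^sup>\<star>\<close> times the value at (x,
      y) is the norm of p x + y minus \<open>D\<close> times the norm of y. For x = d - 1 and y = p
      the two terms agree.\<close>
    define D where "D = 1 - p\<^sup>\<star> * q"
    have "D\<^sup>\<star> = D" using ss(1) s by (auto simp: D_def)
    then obtain d where d: "d * d\<^sup>\<star> = D" using even_norm by blast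
    have "p\<^sup>\<star> * plane_form \<sigma> p q (d - 1) p (d - 1) p = 
      (p * (d - 1) + p) * (p * (d - 1) + p)\<^sup>\<star> - (1 - p\<^sup>\<star> * q) * p * p\<^sup>\<star>"
    proof -
      have "\<sigma> * p\<^sup>\<star> = p" using s by auto
      then have "plane_form \<sigma> p q (d - 1) p (d - 1) p
          = (d\<^sup>\<star> - 1) * (d - 1) * p + (d\<^sup>\<star> - 1) * p + p * (d - 1) + p\<^sup>\<star> * p * q"
        by (simp only: plane_form_def pstar_diff pstar_1)
      then show ?thesis by (simp only: pstar_diff pstar_mult pstar_add pstar_1) (simp add: algebra_simps)
    qed
    also have "\<dots> = p * p\<^sup>\<star> * (d * d\<^sup>\<star>) - D * p * p\<^sup>\<star>" unfolding D_def[symmetric] by (simp add: algebra_simps)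
    finally have "p\<^sup>\<star> * plane_form \<sigma> p q (d - 1) p (d - 1) p = 0"
      by (simp only: d) (simp add: mult.commute)
    with False show ?thesis using that[of "d - 1" p] by simp
  qed
  \<comment> \<open>The gcd of the coordinates is divided out. The value changes by a nonzero norm
    and remains 0.\<close>
  obtain a b where ab: "a * X + b * Y dvd X" "a * X + b * Y dvd Y" using poly_bezout .
  define c where "c = a * X + b * Y"
  obtain x y where xy: "X = c * x" "Y = c * y" using ab[folded c_def] by (elim dvdE)
  with XY(1) have c0: "c \<noteq> 0" by auto
  have "a * (c * x) + b * (c * y) = c" using c_def unfolding xy[symmetric] ..
  then have "c * (a * x + b * y) = c" by (simp add: distrib_left mult.left_commute)
  then have 1: "a * x + b * y = 1" using c0 by simp
  have "plane_form \<sigma> p q X Y X Y = c\<^sup>\<star> * c * plane_form \<sigma> p q x y x y"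
    using plane_form_lin[of \<sigma> p q c x 0 0 y 0 c x 0 0 y 0] xy by simp
  with XY(2) c0 1 show ?thesis by auto
qed

text \<open>A primitive isotropic vector (x, y) and (- c, a) form a basis of determinant 1, in which
  the Gram matrix has the shape of \<open>isotropic_plane_value\<close>. In the skew case the odd
  entry \<open>r\<close> supplies the factor \<open>tvar\<close>.\<close>

lemma plane_value:
  assumes st: "\<sigma> = 1 \<and> \<tau> = 1 \<or> \<sigma> = -1 \<and> \<tau> = tvar"
    and s: "p\<^sup>\<star> = \<sigma> * p" "q\<^sup>\<star> = \<sigma> * (q :: 'a poly)"
  shows "\<exists>x y. plane_form \<sigma> p q x y x y = \<tau>"
proof -
  have s1: "\<sigma> = 1 \<or> \<sigma> = -1" and t: "\<tau>\<^sup>\<star> = \<sigma> * \<tau>" using st by auto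
  obtain x y a c where iso: "a * x + c * y = 1" "plane_form \<sigma> p q x y x y = 0"
    using isotropic_primitive[OF s1 s] by blast
  define b where "b = plane_form \<sigma> p q x y (- c) a"
  define r where "r = plane_form \<sigma> p q (- c) a (- c) a"
  have b': "plane_form \<sigma> p q (- c) a x y = \<sigma> * b\<^sup>\<star>"
    using s1 unfolding b_def plane_form_star[OF s1 s] by auto
  have "r\<^sup>\<star> = \<sigma> * r" unfolding r_def using plane_form_star[OF s1 s] by blast
  then obtain q' where q': "r = \<tau> * q'" "q'\<^sup>\<star> = q'"
    using st odd_tvar[of r] by (metis mult_1 mult_minus1)
  \<comment> \<open>The entry 1 of the old Gram matrix, expanded in the new basis. It shows that
    \<open>b\<close>, its conjugate and \<open>q'\<close> have no common root.\<close>
  have one: "1 = a\<^sup>\<star> * x * b + (- y)\<^sup>\<star> * c * (\<sigma> * b\<^sup>\<star>) + (- y)\<^sup>\<star> * x * (\<tau> * q')"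
  proof -
    have "1 = plane_form \<sigma> p q 1 0 0 1" by (simp add: plane_form_def)
    also have "\<dots> = plane_form \<sigma> p q (a * x + (- y) * (- c)) (a * y + (- y) * a) (c * x + x * (- c)) (c * y + x * a)"
      using iso(1) by (simp add: algebra_simps)
    also have "\<dots> = a\<^sup>\<star> * x * b + (- y)\<^sup>\<star> * c * (\<sigma> * b\<^sup>\<star>) + (- y)\<^sup>\<star> * x * (\<tau> * q')"
      unfolding plane_form_lin by (simp only: iso(2) b' b_def[symmetric] r_def[symmetric] q'(1)) simp
    finally show ?thesis .
  qed
  have "poly b z \<noteq> 0 \<or> poly (b\<^sup>\<star>) z \<noteq> 0 \<or> poly q' z \<noteq> 0" for z
    using arg_cong[OF one, of "\<lambda>p. poly p z"] by auto
  from isotropic_plane_value[OF s1 t q'(2) this] obtain X Y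
    where XY: "X\<^sup>\<star> * Y * b + \<sigma> * X * Y\<^sup>\<star> * b\<^sup>\<star> + \<tau> * q' * Y * Y\<^sup>\<star> = \<tau>" by blast
  have "plane_form \<sigma> p q (X * x + Y * (- c)) (X * y + Y * a) (X * x + Y * (- c)) (X * y + Y * a)
    = X\<^sup>\<star> * Y * b + \<sigma> * X * Y\<^sup>\<star> * b\<^sup>\<star> + \<tau> * q' * Y * Y\<^sup>\<star>"
    unfolding plane_form_lin iso(2) b' b_def[symmetric] r_def[symmetric] q'(1)
    by (simp only: mult_ac add_ac mult_zero_right add_0_left mult_zero_left)
  also have "\<dots> = \<tau>" by (rule XY)
  finally show ?thesis by blast
qed

end

section \<open>Sesquilinear forms and elementary reduction\<close>

definition sesq :: "'a::comm_ring_1 poly^'n^'n \<Rightarrow> 'a poly^'n \<Rightarrow> 'a poly^'n \<Rightarrow> 'a poly" where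
  "sesq A x y = (\<Sum>i\<in>UNIV. \<Sum>j\<in>UNIV. (x$i)\<^sup>\<star> * A$i$j * y$j)"

lemma sesq_add_left: "sesq A (x + x') y = sesq A x y + sesq A x' y"
  and sesq_add_right: "sesq A x (y + y') = sesq A x y + sesq A x y'"
  and sesq_diff_left: "sesq A (x - x') y = sesq A x y - sesq A x' y"
  and sesq_diff_right: "sesq A x (y - y') = sesq A x y - sesq A x y'"
  by (simp_all add: sesq_def algebra_simps sum.distrib sum_subtractf)

lemma sesq_scale_left: "sesq A (c *s x) y = c\<^sup>\<star> * sesq A x y"
  and sesq_scale_right: "sesq A x (c *s y) = c * sesq A x y"
  by (simp_all add: sesq_def sum_distrib_left mult_ac)

lemma sesq_0 [simp]: "sesq A 0 y = 0" "sesq A x 0 = 0"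
  by (simp_all add: sesq_def)

lemmas sesq_lin = sesq_add_left sesq_add_right sesq_diff_left sesq_diff_right sesq_scale_left sesq_scale_right

lemma sesq_axis_left: "sesq A (axis i 1) y = (\<Sum>j\<in>UNIV. A$i$j * y$j)"
proof -
  have "sesq A (axis i 1) y = (\<Sum>k\<in>UNIV. if k = i then \<Sum>j\<in>UNIV. A$k$j * y$j else 0)"
    unfolding sesq_def by (intro sum.cong) (auto simp: axis_def)
  then show ?thesis by simp
qed

lemma sesq_axis [simp]: "sesq A (axis i 1) (axis j 1) = A$i$j"
  unfolding sesq_axis_left by (simp add: axis_def if_distrib cong: if_cong)

lemma sesq_axis_right: "sesq A x (axis j 1) = (\<Sum>i\<in>UNIV. (x$i)\<^sup>\<star> * A$i$j)"
  unfolding sesq_def by (simp add: axis_def if_distrib cong: if_cong)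

lemma sesq_mult: "sesq (mstar P ** A ** Q) x y = sesq A (P *v x) (Q *v y)"
proof -
  have "sesq (mstar P ** A ** Q) x y =
    (\<Sum>i\<in>UNIV. \<Sum>j\<in>UNIV. \<Sum>l\<in>UNIV. \<Sum>k\<in>UNIV. (x$i)\<^sup>\<star> * (P$k$i)\<^sup>\<star> * A$k$l * Q$l$j * y$j)"
    unfolding sesq_def matrix_matrix_mult_def mstar_def
    by (simp add: sum_distrib_left sum_distrib_right mult.assoc)
  also have "\<dots> = (\<Sum>i\<in>UNIV. \<Sum>l\<in>UNIV. \<Sum>j\<in>UNIV. \<Sum>k\<in>UNIV. (x$i)\<^sup>\<star> * (P$k$i)\<^sup>\<star> * A$k$l * Q$l$j * y$j)"
    by (intro sum.cong refl sum.swap)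
  also have "\<dots> = (\<Sum>l\<in>UNIV. \<Sum>i\<in>UNIV. \<Sum>k\<in>UNIV. \<Sum>j\<in>UNIV. (x$i)\<^sup>\<star> * (P$k$i)\<^sup>\<star> * A$k$l * Q$l$j * y$j)"
    by (rule trans[OF sum.swap]) (intro sum.cong refl sum.swap)
  also have "\<dots> = (\<Sum>l\<in>UNIV. \<Sum>k\<in>UNIV. \<Sum>i\<in>UNIV. \<Sum>j\<in>UNIV. (x$i)\<^sup>\<star> * (P$k$i)\<^sup>\<star> * A$k$l * Q$l$j * y$j)"
    by (intro sum.cong refl sum.swap)
  also have "\<dots> = (\<Sum>k\<in>UNIV. \<Sum>l\<in>UNIV. \<Sum>i\<in>UNIV. \<Sum>j\<in>UNIV. (x$i)\<^sup>\<star> * (P$k$i)\<^sup>\<star> * A$k$l * Q$l$j * y$j)"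
    by (rule sum.swap)
  also have "\<dots> = sesq A (P *v x) (Q *v y)"
    unfolding sesq_def matrix_vector_mult_def
    by (simp add: sum_distrib_left sum_distrib_right mult_ac)
  finally show ?thesis .
qed

lemma mult_nth:
  fixes A P Q :: "'a::comm_ring_1 poly^'n^'n"
  shows "(mstar P ** A ** Q)$i$j = sesq A (P *v axis i 1) (Q *v axis j 1)"
  using sesq_mult[of P A Q "axis i 1" "axis j 1"] unfolding sesq_axis .

lemma mstar_mult: "mstar (P ** Q) = mstar Q ** mstar P"
  by (simp add: mstar_def matrix_matrix_mult_def vec_eq_iff mult.commute)

lemma mstar_1 [simp]: "mstar (mat 1) = mat 1"
  by (auto simp: mstar_def mat_def vec_eq_iff)

lemma congruence_comp: "mstar Q ** (mstar P ** A ** P) ** Q = mstar (P ** Q) ** A ** (P ** Q)"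
  by (simp add: mstar_mult matrix_mul_assoc)

text \<open>The sign \<open>\<sigma>\<close> allows the hermitian and the skew-hermitian case to be treated together.\<close>

definition eherm :: "'a::comm_ring_1 poly \<Rightarrow> 'a poly^'n^'n \<Rightarrow> bool" where
  "eherm \<sigma> A \<longleftrightarrow> (\<forall>i j. (A$i$j)\<^sup>\<star> = \<sigma> * A$j$i)"

lemma hermitian_eherm: "hermitian A \<longleftrightarrow> eherm 1 A"
  by (auto simp: hermitian_def eherm_def mstar_def vec_eq_iff)

lemma eherm_sesq: "eherm \<sigma> A \<Longrightarrow> (sesq A x y)\<^sup>\<star> = \<sigma> * sesq A y x"
  unfolding sesq_def eherm_def
  by (subst sum.swap) (simp add: sum_distrib_left mult_ac)

lemma eherm_congruence: "eherm \<sigma> A \<Longrightarrow> eherm \<sigma> (mstar P ** A ** P)"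
  unfolding eherm_def mult_nth by (metis eherm_sesq eherm_def)

text \<open>The free submodule on the basis vectors indexed by \<open>J\<close>. Splitting off a
  summand shrinks \<open>J\<close>, while the type of the matrices stays fixed.\<close>

definition supp :: "'n set \<Rightarrow> ('a::zero)^'n \<Rightarrow> bool" where
  "supp J x \<longleftrightarrow> (\<forall>i. i \<notin> J \<longrightarrow> x$i = 0)"

lemma supp_lin:
  "supp J x \<Longrightarrow> supp J y \<Longrightarrow> supp J (x + y)" "supp J x \<Longrightarrow> supp J y \<Longrightarrow> supp J (x - (y :: 'a::comm_ring_1^'n))"
  "supp J x \<Longrightarrow> supp J (c *s x)" "supp J 0"
  by (auto simp: supp_def)

lemma supp_axis: "i \<in> J \<Longrightarrow> supp J (axis i c)"
  by (auto simp: supp_def axis_def)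

lemma dvd_sesq:
  assumes "supp J x" "supp J y" "\<And>i j. i \<in> J \<Longrightarrow> j \<in> J \<Longrightarrow> c dvd A$i$j"
  shows "c dvd sesq A x y"
  unfolding sesq_def
proof (intro dvd_sum)
  fix i j
  show "c dvd (x$i)\<^sup>\<star> * A$i$j * y$j"
    using assms by (cases "i \<in> J \<and> j \<in> J") (auto simp: supp_def)
qed

text \<open>A nonzero value of least degree divides all values. Division with remainder proves this
  for pairs sharing a vector with (u, v); a general pair is moved to that case.\<close>

lemma ex_content:
  fixes A :: "'a::field poly^'n^'n"
  assumes "i \<in> J" "j \<in> J" "A$i$j \<noteq> 0"
  obtains u v where "supp J u" "supp J v" "sesq A u v \<noteq> 0"
    "\<And>i j. i \<in> J \<Longrightarrow> j \<in> J \<Longrightarrow> sesq A u v dvd A$i$j"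
proof -
  let ?S = "\<lambda>(u, v). supp J u \<and> supp J v \<and> sesq A u v \<noteq> 0"
  have "?S (axis i 1, axis j 1)" using assms by (simp add: supp_axis)
  then obtain uv where uv: "?S uv" "\<And>w. ?S w \<Longrightarrow> degree (sesq A (fst uv) (snd uv)) \<le> degree (sesq A (fst w) (snd w))"
    using ex_has_least_nat[of ?S _ "\<lambda>w. degree (sesq A (fst w) (snd w))"] by blast
  obtain u v where uv': "uv = (u, v)" by fastforce
  define g where "g = sesq A u v"
  have S: "supp J u" "supp J v" "g \<noteq> 0" using uv(1) uv' by (auto simp: g_def)
  have least: "degree g \<le> degree (sesq A x y)" if "supp J x" "supp J y" "sesq A x y \<noteq> 0" for x y
    using uv(2)[of "(x, y)"] that uv' by (simp add: g_def)
  have rest: "r = 0" if "supp J x" "supp J y" "sesq A x y = r" "r = z mod g" for x y r z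
    using least[of x y] that degree_mod_less[OF S(3), of z] by (cases "r = 0") auto
  have right: "g dvd sesq A u' w" if "supp J u'" "sesq A u' v = g" "supp J w" for u' w
  proof -
    let ?q = "sesq A u' w div g"
    have "sesq A u' (w - ?q *s v) = sesq A u' w mod g"
      unfolding sesq_diff_right sesq_scale_right that(2) by (rule minus_div_mult_eq_mod)
    then have "sesq A u' w mod g = 0" using rest[OF that(1) _ _ refl, of "w - ?q *s v"] that S by (simp add: supp_lin)
    then show ?thesis by (rule mod_0_imp_dvd)
  qed
  have left: "g dvd sesq A w v" if "supp J w" for w
  proof -
    let ?q = "sesq A w v div g"
    have "sesq A (w - ?q\<^sup>\<star> *s u) v = sesq A w v mod g"
      unfolding sesq_diff_left sesq_scale_left pstar_pstar g_def[symmetric] by (rule minus_div_mult_eq_mod)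
    then have "sesq A w v mod g = 0" using rest[OF _ S(2) _ refl, of "w - ?q\<^sup>\<star> *s u"] that S by (simp add: supp_lin)
    then show ?thesis by (rule mod_0_imp_dvd)
  qed
  have "g dvd sesq A x y" if xy: "supp J x" "supp J y" for x y
  proof -
    obtain k where k: "sesq A x v = g * k" using left[OF xy(1)] by (auto simp: dvd_def)
    \<comment> \<open>\<open>?x\<close> is \<open>x\<close> corrected to pair to 0 with
      \<open>v\<close>. Hence \<open>u + ?x\<close> pairs with \<open>v\<close> to \<open>g\<close>,
      just as \<open>u\<close> does, and \<open>right\<close> applies to it.\<close>
    let ?x = "x - k\<^sup>\<star> *s u"
    have "sesq A (u + ?x) v = g" by (simp add: sesq_lin k flip: g_def)
    then have "g dvd sesq A (u + ?x) y" using right[of "u + ?x" y] xy S by (simp add: supp_lin)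
    moreover have "sesq A x y = sesq A (u + ?x) y - sesq A u y + k * sesq A u y" by (simp add: sesq_lin)
    moreover have "g dvd sesq A u y" using right[of u y] xy S by (simp add: g_def)
    ultimately show ?thesis by (metis dvd_add dvd_diff dvd_mult)
  qed
  then have "g dvd A$i$j" if "i \<in> J" "j \<in> J" for i j
    using that by (metis sesq_axis supp_axis)
  then show ?thesis using that[of u v] S by (simp add: g_def)
qed

text \<open>The general linear group of the summand indexed by \<open>J\<close>, extended by the
  identity. Full size matrices allow transformations of nested index sets to be multiplied
  directly.\<close>

definition GLJ :: "'n set \<Rightarrow> ('a::comm_ring_1^'n^'n) set" where
  "GLJ J = {P. invertible P \<and> (\<forall>i j. i \<notin> J \<or> j \<notin> J \<longrightarrow> P$i$j = (if i = j then 1 else 0))}"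

lemma GLJ_invertible: "P \<in> GLJ J \<Longrightarrow> invertible P"
  by (simp add: GLJ_def)

lemma GLJ_mono: "P \<in> GLJ J \<Longrightarrow> J \<subseteq> K \<Longrightarrow> P \<in> GLJ K"
  unfolding GLJ_def by blast

lemma GLJ_1: "mat 1 \<in> GLJ J"
  by (auto simp: GLJ_def invertible_def intro!: exI[of _ "mat 1"]) (auto simp: mat_def)

lemma mult_axis_nth: "(P *v axis j 1)$i = (P$i$j :: 'a::comm_ring_1)"
  by (simp add: matrix_vector_mult_def axis_def if_distrib cong: if_cong)

lemma mult_scale_vec: "P *v (c *s x) = c *s (P *v (x :: 'a::comm_ring_1^'n))"
  by (simp add: matrix_vector_mult_def vec_eq_iff sum_distrib_left mult.left_commute)

lemma GLJ_axis: "P \<in> GLJ J \<Longrightarrow> j \<notin> J \<Longrightarrow> P *v axis j 1 = axis j 1"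
  by (auto simp: GLJ_def vec_eq_iff mult_axis_nth) (auto simp: axis_def)

lemma GLJ_supp: "P \<in> GLJ J \<Longrightarrow> supp J x \<Longrightarrow> supp J (P *v x)"
proof -
  assume P: "P \<in> GLJ J" and x: "supp J x"
  have "P$i$j * x$j = 0" if "i \<notin> J" for i j
    using P x that by (cases "j \<in> J") (auto simp: GLJ_def supp_def)
  then show ?thesis by (simp add: supp_def matrix_vector_mult_def)
qed

lemma mult_unit_row:
  assumes "\<And>k. P$i$k = (if i = k then 1 else 0)" shows "(P ** Q)$i$j = Q$i$j"
  using assms by (simp add: matrix_matrix_mult_def if_distrib[of "\<lambda>x. x * _"] cong: if_cong)

lemma mult_unit_column:
  assumes "\<And>k. Q$k$j = (if k = j then 1 else 0)" shows "(P ** Q)$i$j = P$i$j"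
  using assms by (simp add: matrix_matrix_mult_def if_distrib[of "\<lambda>x. _ * x"] cong: if_cong)

lemma invertible_matrix_mult: "invertible P \<Longrightarrow> invertible Q \<Longrightarrow> invertible (P ** (Q :: 'a::comm_ring_1^'n^'n))"
  unfolding invertible_def by (metis matrix_mul_assoc matrix_mul_lid)

lemma GLJ_mult: "P \<in> GLJ J \<Longrightarrow> Q \<in> GLJ J \<Longrightarrow> P ** Q \<in> GLJ J"
proof -
  assume P: "P \<in> GLJ J" and Q: "Q \<in> GLJ J"
  have "(P ** Q)$i$j = (if i = j then 1 else 0)" if "i \<notin> J" for i j
    using P Q that by (subst mult_unit_row) (auto simp: GLJ_def)
  moreover have "(P ** Q)$i$j = (if i = j then 1 else 0)" if "j \<notin> J" for i j
    using P Q that by (subst mult_unit_column) (auto simp: GLJ_def)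
  ultimately show ?thesis using P Q by (auto simp: GLJ_def invertible_matrix_mult)
qed

lemma GLJ_mstar: "P \<in> GLJ J \<Longrightarrow> mstar P \<in> GLJ J"
proof -
  assume P: "P \<in> GLJ J"
  then obtain Q where "P ** Q = mat 1" "Q ** P = mat 1" by (auto simp: GLJ_def invertible_def)
  then have "invertible (mstar P)" unfolding invertible_def by (metis mstar_1 mstar_mult)
  with P show ?thesis by (auto simp: GLJ_def mstar_def)
qed

text \<open>The hypothesis forces \<open>N ** N = 0\<close>.\<close>

lemma GLJ_unipotent:
  assumes "\<And>a b. N$a$b \<noteq> (0::'a::comm_ring_1) \<Longrightarrow> a \<in> S \<and> b \<notin> S \<and> a \<in> J \<and> b \<in> J"
  shows "mat 1 + N \<in> GLJ J"
proof -
  have "N$a$c * N$c$b = 0" for a b c using assms[of a c] assms[of c b] by (metis mult_zero_left mult_zero_right)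
  then have NN: "(\<Sum>c\<in>UNIV. N$a$c * N$c$b) = 0" for a b by simp
  have "(mat 1 + N) ** (mat 1 - N) = mat 1" "(mat 1 - N) ** (mat 1 + N) = mat 1"
    using NN by (simp_all add: matrix_matrix_mult_def vec_eq_iff distrib_left distrib_right left_diff_distrib
        right_diff_distrib sum.distrib sum_subtractf mat_def if_distrib[of "\<lambda>x. x * _"]
        if_distrib[of "\<lambda>x. _ * x"] cong: if_cong)
  then have "invertible (mat 1 + N)" unfolding invertible_def by blast
  then show ?thesis using assms by (auto simp: GLJ_def mat_def)
qed

section \<open>Elementary matrices and Euclidean reduction of vectors\<close>

definition transvection :: "'n \<Rightarrow> 'n \<Rightarrow> 'a::comm_ring_1 \<Rightarrow> 'a^'n^'n" where
  "transvection k i q = mat 1 + (\<chi> a b. if a = k \<and> b = i then q else 0)"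

lemma GLJ_transvection: "k \<in> J \<Longrightarrow> i \<in> J \<Longrightarrow> k \<noteq> i \<Longrightarrow> transvection k i q \<in> GLJ J"
  unfolding transvection_def by (rule GLJ_unipotent[where S = "{k}"]) (auto split: if_splits)

lemma transvection_apply: "transvection k i q *v x = x + axis k (q * x$i)"
proof -
  have "(\<Sum>b\<in>UNIV. (if a = k \<and> b = i then q else 0) * x$b) = (if a = k then q * x$i else 0)" for a
    by (cases "a = k") (simp_all add: if_distrib[of "\<lambda>x. x * _"] cong: if_cong)
  then show ?thesis
    by (simp add: transvection_def matrix_vector_mult_add_rdistrib vec_eq_iff)
       (simp add: matrix_vector_mult_def axis_def)
qed

definition scaling :: "'n \<Rightarrow> 'a::comm_ring_1 \<Rightarrow> 'a^'n^'n" where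
  "scaling j c = (\<chi> a b. if a = b then if a = j then c else 1 else 0)"

lemma scaling_apply: "(scaling j c *v x)$i = (if i = j then c * x$j else x$i)"
  by (simp add: scaling_def matrix_vector_mult_def if_distrib[of "\<lambda>x. x * _"] cong: if_cong)

lemma GLJ_scaling: "j \<in> J \<Longrightarrow> (c :: 'a::comm_ring_1) dvd 1 \<Longrightarrow> scaling j c \<in> GLJ J"
proof -
  assume j: "j \<in> J" and "c dvd 1"
  then obtain d where d: "1 = c * d" by (auto simp: dvd_def)
  have m: "scaling j x ** scaling j y = scaling j (x * y)" for x y :: 'a
    by (simp add: scaling_def matrix_matrix_mult_def vec_eq_iff if_distrib[of "\<lambda>x. x * _"] cong: if_cong)
  have "scaling j (1::'a) = mat 1" by (simp add: scaling_def mat_def vec_eq_iff)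
  with m d have "invertible (scaling j c)" unfolding invertible_def by (metis mult.commute)
  with j show ?thesis by (auto simp: GLJ_def scaling_def)
qed

text \<open>Euclid's algorithm on the coordinates: as long as two are nonzero, one is reduced modulo
  the other. The last one, if any, is moved to position \<open>j\<close>.\<close>

lemma vector_reduction:
  fixes v :: "'a::field poly^'n"
  assumes "supp J v" "j \<in> J"
  shows "\<exists>P\<in>GLJ J. \<exists>g. v = g *s (P *v axis j 1)"
  using assms(1)
\<comment> \<open>\<open>Suc\<close> makes it progress when a constant coordinate becomes 0.\<close>
proof (induction "\<Sum>i\<in>UNIV. if v$i = 0 then 0 else Suc (degree (v$i))" arbitrary: v rule: less_induct)
  case less
  show ?case
  proof (cases "\<exists>i k. i \<noteq> k \<and> v$i \<noteq> 0 \<and> v$k \<noteq> 0")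
    case True
    then obtain i k where ik: "i \<noteq> k" "v$i \<noteq> 0" "v$k \<noteq> 0" "degree (v$i) \<le> degree (v$k)"
      by (metis nat_le_linear)
    then have J: "i \<in> J" "k \<in> J" using less.prems by (auto simp: supp_def)
    define w where "w = (\<chi> a. if a = k then v$k mod v$i else v$a)"
    have "supp J w" using less.prems J by (auto simp: w_def supp_def)
    moreover have "(\<Sum>i\<in>UNIV. if w$i = 0 then 0 else Suc (degree (w$i)))
        < (\<Sum>i\<in>UNIV. if v$i = 0 then 0 else Suc (degree (v$i)))"
    proof (rule sum_strict_mono_ex1)
      have "w$k = 0 \<or> degree (w$k) < degree (v$i)"
        using degree_mod_less[OF ik(2), of "v$k"] by (auto simp: w_def)
      then have *: "(if w$k = 0 then 0 else Suc (degree (w$k))) < (if v$k = 0 then 0 else Suc (degree (v$k)))"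
        using ik by auto
      then show "\<exists>a\<in>UNIV. (if w$a = 0 then 0 else Suc (degree (w$a))) < (if v$a = 0 then 0 else Suc (degree (v$a)))"
        by blast
      show "\<forall>a\<in>UNIV. (if w$a = 0 then 0 else Suc (degree (w$a))) \<le> (if v$a = 0 then 0 else Suc (degree (v$a)))"
      proof
        fix a
        show "(if w$a = 0 then 0 else Suc (degree (w$a))) \<le> (if v$a = 0 then 0 else Suc (degree (v$a)))"
          using * by (cases "a = k") (auto simp: w_def)
      qed
    qed simp
    ultimately obtain P g where P: "P \<in> GLJ J" "w = g *s (P *v axis j 1)" using less.hyps by blast
    have "transvection k i (v$k div v$i) *v w = v"
      using ik(1) by (simp add: transvection_apply vec_eq_iff w_def axis_def mod_div_mult_eq)
    then have "v = g *s ((transvection k i (v$k div v$i) ** P) *v axis j 1)"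
      by (simp add: P(2) mult_scale_vec matrix_vector_mul_assoc[symmetric])
    then have "\<exists>g. v = g *s ((transvection k i (v$k div v$i) ** P) *v axis j 1)" by (rule exI)
    then show ?thesis using GLJ_mult[OF GLJ_transvection[OF J(2,1) ik(1)[symmetric]] P(1)] by (rule bexI)
  next
    case False
    show ?thesis
    proof (cases "v = axis j (v$j)")
      case True
      moreover have "axis j (v$j) = v$j *s (mat 1 *v axis j 1)" by (simp add: vec_eq_iff axis_def)
      ultimately have "v = v$j *s (mat 1 *v axis j 1)" by (rule trans)
      then have "\<exists>g. v = g *s (mat 1 *v axis j 1)" by (rule exI)
      then show ?thesis using GLJ_1 by (rule bexI)
    next
      case v: False
      then obtain i where i: "i \<noteq> j" "v$i \<noteq> 0" by (auto simp: vec_eq_iff axis_def split: if_splits)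
      with less.prems have iJ: "i \<in> J" by (auto simp: supp_def)
      have "v = v$i *s axis i 1" using False i(2) by (auto simp: vec_eq_iff axis_def)
      \<comment> \<open>Adding basis vector i to basis vector j and then removing the latter carries
        one to the other.\<close>
      moreover have "(transvection j i (-1) ** transvection i j 1) *v axis j 1 = (axis i 1 :: 'a poly^'n)"
        using i(1) by (simp add: matrix_vector_mul_assoc[symmetric] transvection_apply) (auto simp: axis_def vec_eq_iff)
      moreover have "transvection j i (-1) ** transvection i j 1 \<in> (GLJ J :: ('a poly^'n^'n) set)"
        using i(1) iJ assms(2) by (intro GLJ_mult GLJ_transvection) auto
      ultimately show ?thesis by (intro bexI[of _ "transvection j i (-1) ** transvection i j 1"] exI[of _ "v$i"]) simp_all
    qed
  qed
qed

text \<open>Every scalar dividing \<open>v\<close> is a unit, so the factor left by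
  \<open>vector_reduction\<close> can be absorbed by a scaling. This turns \<open>v\<close> into a
  basis vector.\<close>

lemma primitive_completion:
  fixes v :: "'a::field poly^'n"
  assumes "supp J v" "j \<in> J" "\<And>g w. v = g *s w \<Longrightarrow> g dvd 1"
  obtains P where "P \<in> GLJ J" "P *v axis j 1 = v"
proof -
  obtain P g where P: "P \<in> GLJ J" "v = g *s (P *v axis j 1)" using vector_reduction assms by blast
  then have "g dvd 1" using assms(3) by blast
  moreover have "scaling j g *v axis j 1 = g *s axis j 1"
    by (simp add: vec_eq_iff scaling_apply axis_def)
  then have "(P ** scaling j g) *v axis j 1 = v"
    using P(2) by (simp add: matrix_vector_mul_assoc[symmetric] mult_scale_vec)
  ultimately show ?thesis using that P GLJ_mult GLJ_scaling assms(2) by metis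
qed

section \<open>Splitting off summands\<close>

text \<open>Used with \<open>w k\<close> the orthogonal projection of basis vector \<open>k\<close>
  onto the summand being split off.\<close>

lemma GLJ_clear:
  assumes "S \<subseteq> J" "\<And>k. supp S (w k :: 'a::comm_ring_1^'n)"
  obtains P where "P \<in> GLJ J" "\<And>k. P *v axis k 1 = (if k \<in> J - S then axis k 1 - w k else axis k 1)"
proof
  let ?N = "\<chi> a b. if b \<in> J - S then - w b $ a else 0"
  show "mat 1 + ?N \<in> GLJ J"
    using assms by (intro GLJ_unipotent[where S = S]) (auto simp: supp_def split: if_splits)
  show "(mat 1 + ?N) *v axis k 1 = (if k \<in> J - S then axis k 1 - w k else axis k 1)" for k
    by (auto simp: vec_eq_iff mult_axis_nth) (auto simp: mat_def axis_def)
qed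

lemma GLJ_inverse:
  assumes "P \<in> GLJ J"
  obtains Q where "Q \<in> GLJ J" "P ** Q = mat 1" "Q ** P = mat 1"
proof -
  obtain Q where Q: "P ** Q = mat 1" "Q ** P = mat 1" using assms by (auto simp: GLJ_def invertible_def)
  have "Q$i$j = (if i = j then 1 else 0)" if "i \<notin> J" for i j
    using assms that mult_unit_row[of P i Q j] Q(1) by (auto simp: GLJ_def mat_def)
  moreover have "Q$i$j = (if i = j then 1 else 0)" if "j \<notin> J" for i j
    using assms that mult_unit_column[of P j Q i] Q(2) by (auto simp: GLJ_def mat_def)
  moreover have "invertible Q" using Q by (auto simp: invertible_def)
  ultimately show ?thesis using Q by (intro that[of Q]) (auto simp: GLJ_def)
qed

lemma dvd_mult_nth:
  assumes "P \<in> GLJ J" "Q \<in> GLJ J" "\<And>i j. i \<in> J \<Longrightarrow> j \<in> J \<Longrightarrow> c dvd A$i$j" "a \<in> J" "b \<in> J"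
  shows "c dvd (mstar P ** A ** Q)$a$b"
  unfolding mult_nth using assms by (intro dvd_sesq[where J = J] GLJ_supp supp_axis) auto

context alg_closed_char_not_2 begin

text \<open>The content divides its conjugate, which has the same degree; the quotient is a constant
  of square 1, and this is the sign that \<open>B\<close> inherits. Monic normalisation serves the
  uniqueness of the invariant factors.\<close>

lemma hermitian_content:
  fixes A :: "'a poly^'n^'n"
  assumes A: "eherm 1 A" and ij: "i \<in> J" "j \<in> J" "A$i$j \<noteq> 0"
  obtains g \<sigma> B u v where "lead_coeff g = 1" "\<sigma> = 1 \<or> \<sigma> = -1" "g\<^sup>\<star> = \<sigma> * g" "eherm \<sigma> B"
    "\<forall>x y. supp J x \<longrightarrow> supp J y \<longrightarrow> sesq A x y = g * sesq B x y"
    "supp J u" "supp J v" "sesq B u v = 1"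
proof -
  obtain u v0 where uv: "supp J u" "supp J v0" "sesq A u v0 \<noteq> 0"
    and dvd: "\<And>i j. i \<in> J \<Longrightarrow> j \<in> J \<Longrightarrow> sesq A u v0 dvd A$i$j"
    using ex_content[OF ij] by metis
  define c where "c = inverse (lead_coeff (sesq A u v0))"
  have c0: "c \<noteq> 0" using uv(3) by (simp add: c_def)
  define v where "v = [:c:] *s v0"
  define g where "g = sesq A u v"
  have g: "g = smult c (sesq A u v0)" by (simp add: g_def v_def sesq_lin)
  have v: "supp J v" using uv by (simp add: v_def supp_lin)
  have lc: "lead_coeff g = 1" using uv(3) by (simp add: g c_def)
  then have g0: "g \<noteq> 0" by auto
  have gd: "g dvd A$i$j" if "i \<in> J" "j \<in> J" for i j
    using dvd[OF that] c0 by (simp add: g smult_dvd_iff)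
  have "g\<^sup>\<star> = sesq A v u" unfolding g_def using eherm_sesq[OF A] by simp
  moreover have "g dvd sesq A v u" using v uv(1) gd by (rule dvd_sesq)
  ultimately obtain k where k: "g\<^sup>\<star> = g * k" by (metis dvdE)
  have "degree g = degree g + degree k"
    using k g0 degree_pstar[of g] by (metis degree_mult_eq mult_eq_0_iff pstar_eq_0_iff)
  then obtain a where a: "k = [:a:]" by (metis add_cancel_right_right degree_eq_zeroE)
  have "g * (k * k\<^sup>\<star>) = g * 1" using k by (metis mult.assoc mult.right_neutral pstar_mult pstar_pstar)
  then have "k * k\<^sup>\<star> = 1" using g0 mult_left_cancel by blast
  then have "k * k = 1" using a by simp
  then have k1: "k = 1 \<or> k = -1" by (simp add: square_eq_1_iff)
  define B :: "'a poly^'n^'n" where "B = (\<chi> i j. if i \<in> J \<and> j \<in> J then A$i$j div g else 0)"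
  have AB: "A$i$j = g * B$i$j" if "i \<in> J" "j \<in> J" for i j
    using gd[OF that] that by (simp add: B_def)
  have "(B$i$j)\<^sup>\<star> = k * B$j$i" for i j
  proof (cases "i \<in> J \<and> j \<in> J")
    case True
    have "(A$i$j)\<^sup>\<star> = A$j$i" using A by (simp add: eherm_def)
    then have "g * (k * (B$i$j)\<^sup>\<star>) = g * B$j$i" using AB True k by (simp add: mult.assoc)
    then have "k * (B$i$j)\<^sup>\<star> = B$j$i" using g0 mult_left_cancel by blast
    then show ?thesis using k1 by (metis minus_minus mult_1 mult_minus1)
  next
    case False
    then show ?thesis by (auto simp: B_def)
  qed
  then have eB: "eherm k B" by (simp add: eherm_def)
  have sAB: "sesq A x y = g * sesq B x y" if "supp J x" "supp J y" for x y
  proof -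
    have "(x$i)\<^sup>\<star> * A$i$j * y$j = g * ((x$i)\<^sup>\<star> * B$i$j * y$j)" for i j
      using that AB[of i j] by (cases "i \<in> J \<and> j \<in> J") (auto simp: supp_def mult_ac)
    then show ?thesis by (simp only: sesq_def sum_distrib_left)
  qed
  have "g * sesq B u v = g * 1" using sAB[OF uv(1) v] by (simp add: g_def)
  then have "sesq B u v = 1" using g0 by simp
  then show ?thesis using that[of g k B u v] lc k1 k eB sAB uv v by (simp add: mult.commute)
qed

text \<open>On the combinations of \<open>u\<close> and \<open>v\<close> the form is a
  \<open>plane_form\<close>, so \<open>plane_value\<close> applies.\<close>

lemma sesq_value:
  assumes B: "eherm \<sigma> (B :: 'a poly^'n^'n)" and uv: "sesq B u v = 1"
    and st: "\<sigma> = 1 \<and> \<tau> = 1 \<or> \<sigma> = -1 \<and> \<tau> = tvar"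
  obtains a b where "sesq B (a *s u + b *s v) (a *s u + b *s v) = \<tau>"
proof -
  have vu: "sesq B v u = \<sigma>" 
    using eherm_sesq[OF B, of u v] uv st by (metis minus_minus mult_1 mult_minus1 pstar_1)
  have "(sesq B u u)\<^sup>\<star> = \<sigma> * sesq B u u" "(sesq B v v)\<^sup>\<star> = \<sigma> * sesq B v v"
    using eherm_sesq[OF B] by blast+
  from plane_value[OF st this] obtain x y where
    "plane_form \<sigma> (sesq B u u) (sesq B v v) x y x y = \<tau>" by blast
  then have "sesq B (x *s u + y *s v) (x *s u + y *s v) = \<tau>"
    by (simp add: sesq_lin vu uv plane_form_def algebra_simps)
  then show ?thesis by (rule that)
qed

text \<open>A common factor of the coordinates enters the value together with its conjugate, which
  contributes twice its degree; but the value has degree at most 1.\<close>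

lemma sesq_value_primitive:
  assumes "sesq B x x = \<tau>" "\<tau> = 1 \<or> \<tau> = tvar" "x = g *s (w :: 'a poly^'n)"
  shows "g dvd 1"
proof -
  have t: "\<tau> \<noteq> 0" "degree \<tau> \<le> 1" using assms(2) by auto
  have e: "\<tau> = g * (g\<^sup>\<star> * sesq B w w)" using assms(1,3) by (simp add: sesq_lin)
  with t have z: "g \<noteq> 0" "sesq B w w \<noteq> 0" by auto
  then have "degree \<tau> = degree g + (degree g + degree (sesq B w w))"
    unfolding e by (simp add: degree_mult_eq)
  then have "degree g = 0" using t by linarith
  then show ?thesis using z(1) by (simp add: is_unit_iff_degree)
qed

text \<open>A vector of value 1 under \<open>B\<close> is primitive and becomes basis vector
  \<open>j\<close>. Its value being a unit, the others are made orthogonal to it without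
  division.\<close>

lemma hermitian_split:
  fixes A :: "'a poly^'n^'n"
  assumes A: "eherm 1 A" and "j \<in> J" and B: "eherm 1 B"
    and AB: "\<And>x y. supp J x \<Longrightarrow> supp J y \<Longrightarrow> sesq A x y = g * sesq B x y"
    and uv: "supp J u" "supp J v" "sesq B u v = 1"
  obtains P where "P \<in> GLJ J" "(mstar P ** A ** P)$j$j = g"
    "\<And>k. k \<in> J - {j} \<Longrightarrow> (mstar P ** A ** P)$j$k = 0"
proof -
  obtain a b where ab: "sesq B (a *s u + b *s v) (a *s u + b *s v) = 1"
    using sesq_value[OF B uv(3)] by blast
  define x where "x = a *s u + b *s v"
  have x: "supp J x" "sesq B x x = 1" using ab uv by (simp_all add: x_def supp_lin)
  obtain P where P: "P \<in> GLJ J" "P *v axis j 1 = x"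
    using primitive_completion[OF x(1) assms(2)] sesq_value_primitive[OF x(2)] by metis
  define M where "M = mstar P ** B ** P"
  have Mjj: "M$j$j = 1" using P(2) x(2) by (simp add: M_def mult_nth)
  obtain Q where Q: "Q \<in> GLJ J"
    "\<And>k. Q *v axis k 1 = (if k \<in> J - {j} then axis k 1 - M$j$k *s axis j 1 else axis k 1)"
    using GLJ_clear[of "{j}" J "\<lambda>k. M$j$k *s axis j 1"] assms(2) by (auto simp: supp_lin supp_axis)
  have PQ: "P ** Q \<in> GLJ J" using P Q GLJ_mult by blast
  have *: "(mstar (P ** Q) ** A ** (P ** Q))$a$b = g * (mstar Q ** M ** Q)$a$b" if "a \<in> J" "b \<in> J" for a b
    unfolding M_def congruence_comp mult_nth
    using that PQ by (intro AB GLJ_supp supp_axis)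
  show ?thesis
  proof (rule that[OF PQ])
    show "(mstar (P ** Q) ** A ** (P ** Q))$j$j = g"
      using assms(2) by (simp add: *) (simp add: mult_nth Q(2) Mjj)
    show "(mstar (P ** Q) ** A ** (P ** Q))$j$k = 0" if "k \<in> J - {j}" for k
      using assms(2) that by (simp add: *) (simp add: mult_nth Q(2) Mjj sesq_lin)
  qed
qed

text \<open>The plane of basis vectors \<open>j\<close> and \<open>l\<close> has determinant
  \<open>tvar * c + 1\<close>, which must be divided by to project onto it. The assumption for
  \<open>a = l\<close> makes this possible. Each remaining entry, times \<open>tvar\<close>, is a
  combination of the assumed multiples, and \<open>tvar\<close> can be cancelled.\<close>

lemma skew_clear:
  fixes B :: "'a poly^'n^'n"
  assumes B: "eherm (-1) B" and jl: "j \<in> J" "l \<in> J" "j \<noteq> l"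
    and e: "B$j$j = tvar" "B$j$l = 1" "B$l$l = c"
    and dvd: "\<And>a b. a \<in> J \<Longrightarrow> b \<in> J \<Longrightarrow> tvar * c + 1 dvd tvar * B$a$b - B$a$j * B$j$b"
  obtains P where "P \<in> GLJ J" "(mstar P ** B ** P)$j$j = tvar" "(mstar P ** B ** P)$j$l = 1" "(mstar P ** B ** P)$l$l = c"
    "\<And>k. k \<in> J - {j, l} \<Longrightarrow> (mstar P ** B ** P)$j$k = 0 \<and> (mstar P ** B ** P)$l$k = 0"
    "\<And>a b. a \<in> J - {j, l} \<Longrightarrow> b \<in> J - {j, l} \<Longrightarrow> tvar * c + 1 dvd (mstar P ** B ** P)$a$b"
proof -
  define f where "f = tvar * c + 1"
  have "(B$j$l)\<^sup>\<star> = - B$l$j" using B by (simp add: eherm_def)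
  then have lj: "B$l$j = -1" using e(2) by (metis add.inverse_inverse pstar_1)
  have "\<forall>k\<in>J. \<exists>\<beta>. tvar * B$l$k + B$j$k = f * \<beta>"
    using dvd[of l] jl lj by (auto simp: f_def dvd_def)
  then obtain \<beta> where \<beta>: "\<And>k. k \<in> J \<Longrightarrow> tvar * B$l$k + B$j$k = f * \<beta> k" by metis
  \<comment> \<open>Orthogonality to the plane reads
    \<open>B$j$k = \<alpha> k * tvar + \<beta> k\<close> and
    \<open>B$l$k = c * \<beta> k - \<alpha> k\<close>; this is Cramer's rule.\<close>
  define \<alpha> where "\<alpha> k = c * \<beta> k - B$l$k" for k
  define w :: "'n \<Rightarrow> 'a poly^'n" where "w k = \<alpha> k *s axis j 1 + \<beta> k *s axis l 1" for k
  have "supp {j, l} (w k)" for k by (simp add: w_def supp_lin supp_axis)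
  then obtain P where P: "P \<in> GLJ J"
    "\<And>k. P *v axis k 1 = (if k \<in> J - {j, l} then axis k 1 - w k else axis k 1)"
    using GLJ_clear[of "{j, l}" J w] jl by auto
  let ?C = "mstar P ** B ** P"
  have z1: "?C$j$k = 0" if "k \<in> J - {j, l}" for k
  proof -
    have "?C$j$k = B$j$k - (\<alpha> k * tvar + \<beta> k)"
      using that by (simp add: mult_nth P(2) w_def sesq_lin e)
    also have "\<dots> = tvar * B$l$k + B$j$k - f * \<beta> k" by (simp add: \<alpha>_def f_def algebra_simps)
    finally show ?thesis using \<beta> that by simp
  qed
  have z2: "?C$l$k = 0" if "k \<in> J - {j, l}" for k
    using that by (simp add: mult_nth P(2) w_def sesq_lin e lj \<alpha>_def mult.commute)
  have d: "f dvd ?C$a$b" if ab: "a \<in> J - {j, l}" "b \<in> J - {j, l}" for a b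
  proof (rule dvd_tvar_mult_cancel)
    have "?C$a$b = sesq B (axis a 1 - w a) (P *v axis b 1)" using ab by (simp add: mult_nth P(2))
    also have "\<dots> = sesq B (axis a 1) (P *v axis b 1) - (\<alpha> a)\<^sup>\<star> * ?C$j$b - (\<beta> a)\<^sup>\<star> * ?C$l$b"
      by (simp add: mult_nth P(2) w_def sesq_lin)
    also have "\<dots> = B$a$b - \<alpha> b * B$a$j - \<beta> b * B$a$l"
      using ab by (simp add: z1 z2) (simp add: P(2) w_def sesq_lin)
    finally have 1: "?C$a$b = B$a$b - \<alpha> b * B$a$j - \<beta> b * B$a$l" .
    have "tvar * \<alpha> b = B$j$b - \<beta> b" using \<beta>[of b] ab by (simp add: \<alpha>_def f_def algebra_simps)
    then have "tvar * ?C$a$b = tvar * B$a$b - (B$j$b - \<beta> b) * B$a$j - tvar * \<beta> b * B$a$l"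
      unfolding 1 by (simp add: right_diff_distrib mult.assoc[symmetric])
    also have "\<dots> = (tvar * B$a$b - B$a$j * B$j$b) - \<beta> b * (tvar * B$a$l - B$a$j * B$j$l)"
      by (simp add: e algebra_simps)
    also have "f dvd \<dots>" using dvd ab jl by (simp add: f_def dvd_diff dvd_mult)
    finally show "f dvd tvar * ?C$a$b" .
    show "poly f 0 \<noteq> 0" by (simp add: f_def)
  qed
  show ?thesis
    by (rule that[OF P(1)]) (use z1 z2 d in \<open>simp_all add: f_def\<close>, simp_all add: mult_nth P(2) e)
qed



text \<open>A single diagonal entry is odd and thus divisible by t. Consequently an odd content
  always finds a second index to build its plane.\<close>

lemma skew_not_singleton:
  fixes B :: "'a poly^'n^'n"
  assumes B: "eherm (-1) B" and uv: "supp {j} u" "supp {j} v"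
  shows "sesq B u v \<noteq> 1"
proof
  assume 1: "sesq B u v = 1"
  have "(B$j$j)\<^sup>\<star> = - B$j$j" using B by (simp add: eherm_def)
  then have "tvar dvd B$j$j" using odd_at_0 tvar_dvd_iff by blast
  then have "tvar dvd sesq B u v" using uv by (intro dvd_sesq[of "{j}"]) auto
  then show False unfolding 1 tvar_dvd_iff by simp
qed

text \<open>At t = 0 the form is alternating, with u and v pairing to 1. The coefficients of x do
  not both vanish at 0, or t would divide a vector of value t; so x pairs with u or v to something
  nonzero at 0.\<close>

lemma skew_represents_tvar:
  fixes B :: "'a poly^'n^'n"
  assumes B: "eherm (-1) B" and uv: "supp J u" "supp J v" "sesq B u v = 1"
  obtains x y where "supp J x" "sesq B x x = tvar" "supp J y" "poly (sesq B x y) 0 \<noteq> 0"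
proof -
  obtain a b where ab: "sesq B (a *s u + b *s v) (a *s u + b *s v) = tvar"
    using sesq_value[OF B uv(3), of tvar] by blast
  let ?x = "a *s u + b *s v"
  have x: "supp J ?x" using uv by (simp add: supp_lin)
  have "sesq B v u = -1" using eherm_sesq[OF B, of u v] uv by (metis minus_minus mult_minus1 pstar_1)
  moreover have "poly (sesq B u u) 0 = 0" "poly (sesq B v v) 0 = 0"
    using eherm_sesq[OF B] odd_at_0 by (metis mult_minus1)+
  ultimately have at0: "poly (sesq B ?x u) 0 = - poly b 0" "poly (sesq B ?x v) 0 = poly a 0"
    using uv by (simp_all add: sesq_lin)
  have "poly a 0 \<noteq> 0 \<or> poly b 0 \<noteq> 0"
  proof (rule ccontr)
    assume "\<not> ?thesis"
    then obtain a' b' where "a = tvar * a'" "b = tvar * b'" by (metis tvar_dvd_iff dvdE)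
    then have "?x = tvar *s (a' *s u + b' *s v)" by (simp add: vec_eq_iff algebra_simps)
    from sesq_value_primitive[OF ab _ this] have "tvar dvd (1 :: 'a poly)" by simp
    then show False by (simp add: tvar_dvd_iff)
  qed
  then show ?thesis using that[OF x ab, of u] that[OF x ab, of v] uv at0 by auto
qed

text \<open>Up to the factor \<open>tvar\<close>, the matrix \<open>K\<close> below is the Gram matrix of the form on the orthogonal
  projections away from \<open>x\<close>. It is hermitian and nonzero at \<open>0\<close>, so its content is even and hence
  represented; a vector representing it spans with \<open>x\<close> an orthogonal summand.\<close>

lemma skew_split:
  fixes B :: "'a poly^'n^'n"
  assumes B: "eherm (-1) B" and uv: "supp J u" "supp J v" "sesq B u v = 1"
    and jl: "j \<in> J" "l \<in> J" "j \<noteq> l"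
  obtains P c where "P \<in> GLJ J" "(mstar P ** B ** P)$j$j = tvar" "(mstar P ** B ** P)$j$l = 1"
    "(mstar P ** B ** P)$l$l = c"
    "\<And>k. k \<in> J - {j, l} \<Longrightarrow> (mstar P ** B ** P)$j$k = 0 \<and> (mstar P ** B ** P)$l$k = 0"
    "\<And>a b. a \<in> J - {j, l} \<Longrightarrow> b \<in> J - {j, l} \<Longrightarrow> tvar * c + 1 dvd (mstar P ** B ** P)$a$b"
proof -
  obtain x y where xy: "supp J x" "sesq B x x = tvar" "supp J y" "poly (sesq B x y) 0 \<noteq> 0"
    using skew_represents_tvar[OF B uv] .
  obtain P where P: "P \<in> GLJ J" "P *v axis j 1 = x"
    using primitive_completion[OF xy(1) jl(1)] sesq_value_primitive[OF xy(2)] by metis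
  define M where "M = mstar P ** B ** P"
  have M: "eherm (-1) M" unfolding M_def using B by (rule eherm_congruence)
  have Ms: "(M$a$b)\<^sup>\<star> = - M$b$a" for a b using M by (simp add: eherm_def)
  have Mjj: "M$j$j = tvar" by (simp add: M_def mult_nth P(2) xy(2))
  \<comment> \<open>If all these entries vanished at 0, so would the pairing of \<open>x\<close>
    with \<open>y\<close>, because \<open>M$j$j = tvar\<close> vanishes as well. At 0 the entry
    \<open>K$k$k\<close> is the square of \<open>M$j$k\<close>.\<close>
  obtain k where k: "k \<in> J - {j}" "poly (M$j$k) 0 \<noteq> 0"
  proof -
    obtain Q where Q: "Q \<in> GLJ J" "P ** Q = mat 1" using GLJ_inverse[OF P(1)] by metis
    have "sesq M (axis j 1) (Q *v y) = sesq B x y"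
      unfolding M_def sesq_mult P(2) by (simp add: matrix_vector_mul_assoc Q(2))
    moreover have "tvar dvd sesq M (axis j 1) (Q *v y)" if "\<And>k. k \<in> J - {j} \<Longrightarrow> tvar dvd M$j$k"
      unfolding sesq_axis_left
    proof (rule dvd_sum)
      fix i
      have "supp J (Q *v y)" using GLJ_supp[OF Q(1) xy(3)] .
      then show "tvar dvd M$j$i * (Q *v y)$i"
        using that[of i] Mjj by (cases "i \<in> J"; cases "i = j") (auto simp: supp_def)
    qed
    ultimately have "\<exists>k\<in>J - {j}. poly (M$j$k) 0 \<noteq> 0" using xy(4) unfolding tvar_dvd_iff by auto
    then show ?thesis using that by blast
  qed
  define K :: "'a poly^'n^'n" where "K = (\<chi> a b. tvar * M$a$b - M$a$j * M$j$b)"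
  have K: "eherm 1 K" by (simp add: eherm_def K_def Ms mult.commute)
  have Kj: "K$j$a = 0" "K$a$j = 0" for a by (simp_all add: K_def Mjj mult.commute)
  have sK: "sesq K a b = tvar * sesq M a b - sesq M a (axis j 1) * sesq M (axis j 1) b" for a b
  proof -
    have "sesq M a (axis j 1) * sesq M (axis j 1) b
      = (\<Sum>i\<in>UNIV. \<Sum>k\<in>UNIV. (a$i)\<^sup>\<star> * M$i$j * (M$j$k * b$k))"
      unfolding sesq_axis_left sesq_axis_right by (simp add: sum_product)
    then show ?thesis
      unfolding sesq_def K_def by (simp add: sum_distrib_left sum_subtractf algebra_simps)
  qed
  have Kkk: "poly (K$k$k) 0 \<noteq> 0"
  proof -
    have "M$k$j = - (M$j$k)\<^sup>\<star>" by (simp add: Ms)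
    then show ?thesis using k(2) by (simp add: K_def)
  qed
  then have "K$k$k \<noteq> 0" by auto
  from hermitian_content[OF K k(1) k(1) this] obtain g \<sigma> K' u' v'
    where "lead_coeff g = 1" and g: "\<sigma> = 1 \<or> \<sigma> = -1" "g\<^sup>\<star> = \<sigma> * g" "eherm \<sigma> K'"
    and KK': "\<forall>x y. supp (J - {j}) x \<longrightarrow> supp (J - {j}) y \<longrightarrow> sesq K x y = g * sesq K' x y"
    and uv': "supp (J - {j}) u'" "supp (J - {j}) v'" "sesq K' u' v' = 1"
    .
  have K_nth: "K$a$b = g * sesq K' (axis a 1) (axis b 1)" if "a \<in> J - {j}" "b \<in> J - {j}" for a b
    using KK'[rule_format, OF supp_axis[OF that(1), of 1] supp_axis[OF that(2), of 1]] by simp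
  then have "poly g 0 \<noteq> 0" using Kkk k(1) by (metis mult_zero_left poly_mult)
  then have "\<sigma> = 1" using g(1,2) odd_at_0[of g] by (metis mult_minus1)
  then obtain a b where ab: "sesq K' (a *s u' + b *s v') (a *s u' + b *s v') = 1"
    using sesq_value[OF g(3) uv'(3), of 1] by blast
  define z where "z = a *s u' + b *s v'"
  have z: "supp (J - {j}) z" "sesq K' z z = 1" using ab uv' by (simp_all add: z_def supp_lin)
  define \<beta> where "\<beta> = poly (sesq M (axis j 1) z) 0"
  have "sesq M z (axis j 1) = - (sesq M (axis j 1) z)\<^sup>\<star>" using eherm_sesq[OF M] by simp
  then have "poly (sesq K z z) 0 = \<beta> * \<beta>" by (simp add: sK \<beta>_def)
  moreover have Kz: "sesq K z z = g" using KK'[rule_format, OF z(1) z(1)] z(2) by simp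
  ultimately have \<beta>: "\<beta> \<noteq> 0" using \<open>poly g 0 \<noteq> 0\<close> by auto
  \<comment> \<open>Rescaled so that the pairing with basis vector \<open>j\<close> has constant
    term 1.\<close>
  define y' where "y' = [:inverse \<beta>:] *s z"
  have "z = ([:\<beta>:] * h) *s w" if "y' = h *s w" for h w
  proof -
    have "[:\<beta>:] *s y' = z" using \<beta> by (simp add: y'_def vec_eq_iff)
    then show ?thesis unfolding that by (simp add: vec_eq_iff mult.assoc)
  qed
  then have prim: "h dvd 1" if "y' = h *s w" for h w
    using sesq_value_primitive[OF z(2)] that dvd_mult_right by blast
  have y': "supp (J - {j}) y'" using z by (simp add: y'_def supp_lin)
  obtain Q where Q: "Q \<in> GLJ (J - {j})" "Q *v axis l 1 = y'"
    using primitive_completion[OF y', of l] prim jl by (metis DiffI singletonD)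
  have Qj: "Q *v axis j 1 = axis j 1" using GLJ_axis[OF Q(1)] by simp
  have "poly (sesq M (axis j 1) y') 0 = 1" using \<beta> by (simp add: y'_def sesq_lin \<beta>_def)
  \<comment> \<open>The excess over 1 is a multiple of t, the value of basis vector
    \<open>j\<close>; subtracting \<open>m\<close> times that vector makes the pairing exactly
    1.\<close>
  then obtain m where m: "sesq M (axis j 1) y' = 1 + tvar * m"
    using const_plus_tvar_mult[of "sesq M (axis j 1) y'"] by (metis one_pCons)
  define R :: "'a poly^'n^'n" where "R = Q ** transvection j l (- m)"
  have R: "R \<in> GLJ J" unfolding R_def
    using GLJ_mono[OF Q(1)] jl by (intro GLJ_mult GLJ_transvection) auto
  have Rj: "R *v axis j 1 = axis j 1"
  proof -
    have "transvection j l (- m) *v axis j 1 = axis j 1"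
      using jl by (simp add: transvection_apply vec_eq_iff axis_def)
    then show ?thesis by (simp add: R_def matrix_vector_mul_assoc[symmetric] Qj)
  qed
  have Rl: "R *v axis l 1 = y' - m *s axis j 1"
  proof -
    have "transvection j l (- m) *v axis l 1 = axis l 1 - m *s axis j 1"
      by (simp add: transvection_apply vec_eq_iff axis_def)
    then show ?thesis
      by (simp add: R_def matrix_vector_mul_assoc[symmetric] matrix_vector_mult_diff_distrib mult_scale_vec Q(2) Qj)
  qed
  define C where "C = mstar R ** M ** R"
  have C: "eherm (-1) C" unfolding C_def using M by (rule eherm_congruence)
  have Cjj: "C$j$j = tvar" by (simp add: C_def mult_nth Rj Mjj)
  have Cjl: "C$j$l = 1" by (simp add: C_def mult_nth Rj Rl sesq_lin m Mjj mult.commute)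
  have CK: "tvar * C$a$b - C$a$j * C$j$b = sesq K (R *v axis a 1) (R *v axis b 1)" for a b
    by (simp add: sK C_def mult_nth Rj)
  have "(C$j$l)\<^sup>\<star> = - C$l$j" using C by (simp add: eherm_def)
  then have Clj: "C$l$j = -1" using Cjl by (metis minus_minus pstar_1)
  have sKj: "sesq K w (axis j 1) = 0" "sesq K (axis j 1) w = 0" for w
    unfolding sesq_axis_left sesq_axis_right by (simp_all add: Kj)
  \<comment> \<open>\<open>K\<close> ignores multiples of basis vector \<open>j\<close>, so the
    determinant of the plane is the content \<open>g\<close> up to a nonzero constant.\<close>
  have "tvar * C$l$l + 1 = sesq K (R *v axis l 1) (R *v axis l 1)"
    unfolding CK[symmetric] by (simp add: Cjl Clj)
  also have "\<dots> = [:inverse \<beta> * inverse \<beta>:] * g" unfolding Rl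
    by (simp add: sesq_lin sKj Kj y'_def Kz)
  finally have f: "tvar * C$l$l + 1 = [:inverse \<beta> * inverse \<beta>:] * g" .
  have "tvar * C$l$l + 1 dvd tvar * C$a$b - C$a$j * C$j$b" if "a \<in> J" "b \<in> J" for a b
    unfolding CK
  proof (rule dvd_sesq)
    show "supp J (R *v axis a 1)" "supp J (R *v axis b 1)" using that R by (auto intro: GLJ_supp supp_axis)
    show "tvar * C$l$l + 1 dvd K$i$k" if "i \<in> J" "k \<in> J" for i k
    proof -
      have "g dvd K$i$k" using K_nth[of i k] that Kj by (cases "i = j \<or> k = j") auto
      then show ?thesis unfolding f using \<beta> by (simp add: smult_dvd_iff)
    qed
  qed
  from skew_clear[OF C jl Cjj Cjl refl this] obtain S where S: "S \<in> GLJ J"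
    "(mstar S ** C ** S)$j$j = tvar" "(mstar S ** C ** S)$j$l = 1" "(mstar S ** C ** S)$l$l = C$l$l"
    "\<And>k. k \<in> J - {j, l} \<Longrightarrow> (mstar S ** C ** S)$j$k = 0 \<and> (mstar S ** C ** S)$l$k = 0"
    "\<And>a b. a \<in> J - {j, l} \<Longrightarrow> b \<in> J - {j, l} \<Longrightarrow> tvar * C$l$l + 1 dvd (mstar S ** C ** S)$a$b"
    by metis
  have eq: "mstar S ** C ** S = mstar (P ** R ** S) ** B ** (P ** R ** S)"
    unfolding C_def M_def congruence_comp by (simp add: matrix_mul_assoc)
  show ?thesis
  proof (rule that)
    show "P ** R ** S \<in> GLJ J" using P R S by (intro GLJ_mult)
  qed (use S in \<open>simp_all add: eq\<close>)
qed

end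

section \<open>Normal form\<close>

definition sep :: "'n set \<Rightarrow> ('a::zero)^'n^'n \<Rightarrow> bool" where
  "sep J A \<longleftrightarrow> (\<forall>i j. (i \<in> J) \<noteq> (j \<in> J) \<longrightarrow> A$i$j = 0)"

text \<open>Since no entry links \<open>J\<close> to its complement, later transformations inside
  \<open>J\<close> do not disturb the blocks already split off.\<close>

lemma sep_mult_nth:
  fixes A X Y :: "'a::comm_ring_1 poly^'n^'n"
  assumes A: "sep J A" and XY: "X \<in> GLJ J" "Y \<in> GLJ J" and ab: "\<not> (a \<in> J \<and> b \<in> J)"
  shows "(mstar X ** A ** Y)$a$b = A$a$b"
proof -
  consider "a \<notin> J" "b \<notin> J" | "a \<notin> J" "b \<in> J" | "a \<in> J" "b \<notin> J" using ab by blast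
  then show ?thesis
  proof cases
    case 1
    then show ?thesis by (simp add: mult_nth GLJ_axis[OF XY(1)] GLJ_axis[OF XY(2)])
  next
    case 2
    have "supp J (Y *v axis b 1)" using GLJ_supp[OF XY(2) supp_axis[OF 2(2)]] .
    then have "A$a$k * (Y *v axis b 1)$k = 0" for k
      using A 2 by (cases "k \<in> J") (auto simp: supp_def sep_def)
    then show ?thesis using A 2 by (simp add: mult_nth GLJ_axis[OF XY(1)] sesq_axis_left sep_def)
  next
    case 3
    have "supp J (X *v axis a 1)" using GLJ_supp[OF XY(1) supp_axis[OF 3(1)]] .
    then have "((X *v axis a 1)$k)\<^sup>\<star> * A$k$b = 0" for k
      using A 3 by (cases "k \<in> J") (auto simp: supp_def sep_def)
    then show ?thesis using A 3 by (simp add: mult_nth GLJ_axis[OF XY(2)] sesq_axis_right sep_def)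
  qed
qed

lemma sep_mult: "sep J A \<Longrightarrow> X \<in> GLJ J \<Longrightarrow> Y \<in> GLJ J \<Longrightarrow> sep J (mstar X ** A ** Y)"
  using sep_mult_nth[of J A X Y] by (auto simp: sep_def)

text \<open>The matrices with rows and columns indexed by a list \<open>js\<close> of indices. An even invariant factor \<open>d\<close>
  contributes a diagonal entry, an odd one is paired with its successor \<open>e\<close> and contributes
  \<open>d\<close> times the block with rows \<open>(t, 1)\<close> and \<open>(-1, (f - 1) / t)\<close>, where \<open>f\<close> is the multiple of \<open>e / d\<close>
  with constant term \<open>1\<close>.\<close>

definition corner :: "'a::field poly \<Rightarrow> 'a poly \<Rightarrow> 'a poly" where
  "corner d e = (smult (inverse (poly (e div d) 0)) (e div d) - 1) div tvar"

fun normal_form :: "'n list \<Rightarrow> 'a::field poly list \<Rightarrow> 'n \<Rightarrow> 'n \<Rightarrow> 'a poly" where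
  "normal_form (j # js) (d # ds) a b =
    (if d\<^sup>\<star> = d then if a = j \<or> b = j then if a = b then d else 0 else normal_form js ds a b
     else case js of [] \<Rightarrow> 0 | l # js' \<Rightarrow> case ds of [] \<Rightarrow> 0 | e # ds' \<Rightarrow>
       if a = j then if b = j then d * tvar else if b = l then d else 0
       else if a = l then if b = j then - d else if b = l then d * corner d e else 0
       else if b = j \<or> b = l then 0 else normal_form js' ds' a b)"
| "normal_form _ _ a b = 0"

text \<open>What a block of \<open>normal_form\<close> requires: a factor that is not even has a
  successor \<open>e\<close>, and the constant term of \<open>e div d\<close> can be normalised to
  1.\<close>

fun admissible :: "'a::field poly list \<Rightarrow> bool" where
  "admissible (d # ds) = (if d\<^sup>\<star> = d then admissible ds
     else case ds of [] \<Rightarrow> False | e # ds' \<Rightarrow> d dvd e \<and> poly (e div d) 0 \<noteq> 0 \<and> admissible ds')"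
| "admissible [] = True"

text \<open>With a divisibility chain this is the Smith form, through which the invariant factors
  are compared.\<close>

fun diagonal_form :: "'n list \<Rightarrow> 'a::zero list \<Rightarrow> 'n \<Rightarrow> 'n \<Rightarrow> 'a" where
  "diagonal_form (j # js) (d # ds) a b = (if a = j \<or> b = j then if a = b then d else 0 else diagonal_form js ds a b)"
| "diagonal_form _ _ a b = 0"

lemma normal_form_zeros: "normal_form js (replicate n 0) a b = 0"
  by (induction js arbitrary: n) (case_tac n; simp)+

lemma admissible_zeros: "admissible (replicate n 0)"
  by (induction n) auto

context alg_closed_char_not_2 begin

text \<open>The clause on common divisors \<open>c\<close> drives the induction: the factors just
  split off divide the remaining block, hence all later factors, and the list is a chain.\<close>

lemma normal_form_exists:
  fixes A :: "'a poly^'n^'n"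
  assumes "distinct js" "eherm 1 A" "sep (set js) A"
  shows "\<exists>P\<in>GLJ (set js). \<exists>ds. length ds = length js \<and> sorted_wrt (dvd) ds \<and> admissible ds \<and>
    (\<forall>d\<in>set ds. d = 0 \<or> lead_coeff d = 1) \<and>
    (\<forall>c. (\<forall>a\<in>set js. \<forall>b\<in>set js. c dvd A$a$b) \<longrightarrow> (\<forall>d\<in>set ds. c dvd d)) \<and>
    (\<forall>a\<in>set js. \<forall>b\<in>set js. (mstar P ** A ** P)$a$b = normal_form js ds a b)"
  using assms
proof (induction "length js" arbitrary: js A rule: less_induct)
  case less
  note A = \<open>eherm 1 A\<close> and sA = \<open>sep (set js) A\<close>
  show ?case
  proof (cases "\<forall>a\<in>set js. \<forall>b\<in>set js. A$a$b = 0")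
    case True
    then show ?thesis
      by (intro bexI[of _ "mat 1"] exI[of _ "replicate (length js) 0"] GLJ_1)
        (auto simp: normal_form_zeros admissible_zeros sorted_wrt_iff_nth_less)
  next
    case False
    then obtain a0 b0 where ab0: "a0 \<in> set js" "b0 \<in> set js" "A$a0$b0 \<noteq> 0" by blast
    from hermitian_content[OF A ab0] obtain g \<sigma> B u v where lc: "lead_coeff g = 1"
      and g: "\<sigma> = 1 \<or> \<sigma> = -1" "g\<^sup>\<star> = \<sigma> * g" and B: "eherm \<sigma> B"
      and AB: "\<forall>x y. supp (set js) x \<longrightarrow> supp (set js) y \<longrightarrow> sesq A x y = g * sesq B x y"
      and uv: "supp (set js) u" "supp (set js) v" "sesq B u v = 1" .
    have g0: "g \<noteq> 0" using lc by auto
    have gA: "g dvd A$a$b" if "a \<in> set js" "b \<in> set js" for a b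
      using AB[rule_format, OF supp_axis[OF that(1), of 1] supp_axis[OF that(2), of 1]] by simp
    obtain j js0 where js: "js = j # js0" using ab0(1) by (cases js) auto
    show ?thesis
    proof (cases "\<sigma> = 1")
      case True
      have j: "j \<in> set js" using js by simp
      obtain P where P: "P \<in> GLJ (set js)" and Pj: "(mstar P ** A ** P)$j$j = g"
        "\<And>k. k \<in> set js - {j} \<Longrightarrow> (mstar P ** A ** P)$j$k = 0"
        using hermitian_split[OF A j B[unfolded True] AB[rule_format] uv] by blast
      define A1 where "A1 = mstar P ** A ** P"
      have A1: "eherm 1 A1" unfolding A1_def using A by (rule eherm_congruence)
      have row: "A1$j$k = (if k = j then g else 0)" for k
        using Pj sep_mult[OF sA P P] js unfolding A1_def[symmetric] by (cases "k \<in> set js") (auto simp: sep_def)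
      then have col: "A1$k$j = (if k = j then g else 0)" for k
        using A1 unfolding eherm_def by (metis mult_1 pstar_0)
      have "sep (set js0) A1"
        unfolding sep_def
      proof (intro allI impI)
        fix i k assume ik: "(i \<in> set js0) \<noteq> (k \<in> set js0)"
        have "(i \<in> set js) \<noteq> (k \<in> set js) \<longrightarrow> A1$i$k = 0"
          using sep_mult[OF sA P P] unfolding A1_def[symmetric] sep_def by blast
        with ik show "A1$i$k = 0" using row[of k] col[of i] js less.prems(1)
          by (cases "i = j \<or> k = j") (auto split: if_splits)
      qed
      then obtain Q ds where Q: "Q \<in> GLJ (set js0)" and ds: "length ds = length js0" "sorted_wrt (dvd) ds"
        "admissible ds" "\<forall>d\<in>set ds. d = 0 \<or> lead_coeff d = 1"
        "\<And>c. (\<And>a b. a \<in> set js0 \<Longrightarrow> b \<in> set js0 \<Longrightarrow> c dvd A1$a$b) \<Longrightarrow> (\<forall>d\<in>set ds. c dvd d)"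
        "\<forall>a\<in>set js0. \<forall>b\<in>set js0. (mstar Q ** A1 ** Q)$a$b = normal_form js0 ds a b"
        using less.hyps[of js0 A1, OF _ _ A1] less.prems(1) unfolding js by auto
      have cA1: "c dvd A1$a$b" if "\<And>a b. a \<in> set js \<Longrightarrow> b \<in> set js \<Longrightarrow> c dvd A$a$b" "a \<in> set js" "b \<in> set js" for c a b
        unfolding A1_def using that by (intro dvd_mult_nth[OF P P])
      have gds: "\<forall>d\<in>set ds. g dvd d" using ds(5)[of g] cA1[OF gA] js by simp
      then have m1: "sorted_wrt (dvd) (g # ds)" using ds(2) by simp
      have m2: "admissible (g # ds)" using ds(3) g True by simp
      have m3: "\<forall>d\<in>set (g # ds). c dvd d" if "\<forall>a\<in>set js. \<forall>b\<in>set js. c dvd A$a$b" for c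
      proof -
        have "c dvd A1$j$j" using cA1[of c j j] that j by blast
        then have "c dvd g" using row[of j] by simp
        then show ?thesis using gds by (auto intro: dvd_trans)
      qed
      have m4: "(mstar (P ** Q) ** A ** (P ** Q))$a$b = normal_form js (g # ds) a b" if "a \<in> set js" "b \<in> set js" for a b
      proof (cases "a = j \<or> b = j")
        case True
        then have "\<not> (a \<in> set js0 \<and> b \<in> set js0)" using less.prems(1) js by auto
        then have "(mstar Q ** A1 ** Q)$a$b = A1$a$b" using sep_mult_nth[OF \<open>sep (set js0) A1\<close> Q Q] by blast
        with True show ?thesis using row col g \<open>\<sigma> = 1\<close> js by (auto simp: A1_def congruence_comp)
      next
        case False
        then show ?thesis using ds(6) that js g \<open>\<sigma> = 1\<close> by (auto simp: A1_def congruence_comp)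
      qed
      have m5: "P ** Q \<in> GLJ (set js)" using P GLJ_mono[OF Q, of "set js"] js by (intro GLJ_mult) auto
      have m6: "length (g # ds) = length js" "\<forall>d\<in>set (g # ds). d = 0 \<or> lead_coeff d = 1"
        using ds(1,4) js lc by simp_all
      show ?thesis using m1 m2 m3 m4 m6
        by (intro bexI[OF _ m5] exI[of _ "g # ds"]) blast
    next
      case False
      with g have \<sigma>: "\<sigma> = -1" by simp
      \<comment> \<open>\<open>normal_form\<close> and \<open>admissible\<close> branch on equality
        with the conjugate, so the odd \<open>g\<close> must not be even as well.\<close>
      have gs: "g\<^sup>\<star> \<noteq> g"
      proof
        assume "g\<^sup>\<star> = g"
        then have "2 * g = 0" using g(2) \<sigma> by (metis add.right_inverse mult_2 mult_minus1)
        then show False using g0 two_poly by simp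
      qed
      have B: "eherm (-1) B" using B \<sigma> by simp
      obtain l js1 where js0: "js0 = l # js1"
        using skew_not_singleton[OF B, of j u v] uv js by (cases js0) auto
      have jl: "j \<in> set js" "l \<in> set js" "j \<noteq> l" using js js0 less.prems(1) by auto
      have set: "set js - {j, l} = set js1" using js js0 less.prems(1) by auto
      then have js1: "k \<in> set js1" if "k \<in> set js" "k \<noteq> j" "k \<noteq> l" for k using that by blast
      obtain P c where P: "P \<in> GLJ (set js)" and Pjl: "(mstar P ** B ** P)$j$j = tvar" "(mstar P ** B ** P)$j$l = 1"
        "(mstar P ** B ** P)$l$l = c"
        "\<And>k. k \<in> set js1 \<Longrightarrow> (mstar P ** B ** P)$j$k = 0 \<and> (mstar P ** B ** P)$l$k = 0"
        "\<And>a b. a \<in> set js1 \<Longrightarrow> b \<in> set js1 \<Longrightarrow> tvar * c + 1 dvd (mstar P ** B ** P)$a$b"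
        using skew_split[OF B uv jl] unfolding set by metis
      define A1 where "A1 = mstar P ** A ** P"
      have A1: "eherm 1 A1" unfolding A1_def using A by (rule eherm_congruence)
      have A1B: "A1$a$b = g * (mstar P ** B ** P)$a$b" if "a \<in> set js" "b \<in> set js" for a b
        unfolding A1_def mult_nth using that by (intro AB[rule_format] GLJ_supp[OF P] supp_axis)
      have sA1: "sep (set js) A1" unfolding A1_def by (rule sep_mult[OF sA P P])
      have rowj: "A1$j$k = (if k = j then g * tvar else if k = l then g else 0)" for k
        using Pjl(1,2) Pjl(4)[of k] sA1 jl js1[of k] by (cases "k \<in> set js") (auto simp: A1B sep_def)
      have star: "A1$k$i = (A1$i$k)\<^sup>\<star>" for i k using A1 by (simp add: eherm_def)
      have rowl: "A1$l$k = (if k = j then - g else if k = l then g * c else 0)" for k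
        using Pjl(3) Pjl(4)[of k] sA1 jl js1[of k] star[of l j] rowj[of l] g(2) \<sigma>
        by (cases "k \<in> set js") (auto simp: A1B sep_def)
      have col: "A1$k$j = 0" "A1$k$l = 0" if "k \<noteq> j" "k \<noteq> l" for k
        using star[of k] rowj[of k] rowl[of k] that by auto
      have "sep (set js1) A1"
        using rowj rowl col sA1 unfolding sep_def set[symmetric] by (metis Diff_iff insert_iff singletonD)
      then obtain Q ds where Q: "Q \<in> GLJ (set js1)" and ds: "length ds = length js1" "sorted_wrt (dvd) ds"
        "admissible ds" "\<forall>d\<in>set ds. d = 0 \<or> lead_coeff d = 1"
        "\<And>c. (\<And>a b. a \<in> set js1 \<Longrightarrow> b \<in> set js1 \<Longrightarrow> c dvd A1$a$b) \<Longrightarrow> (\<forall>d\<in>set ds. c dvd d)"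
        "\<forall>a\<in>set js1. \<forall>b\<in>set js1. (mstar Q ** A1 ** Q)$a$b = normal_form js1 ds a b"
        using less.hyps[of js1 A1] A1 less.prems(1) js js0 by auto
      define f where "f = tvar * c + 1"
      have f0: "poly f 0 = 1" by (simp add: f_def)
      then have fn: "f \<noteq> 0" by auto
      \<comment> \<open>The second factor is \<open>g * f\<close> made monic. Dividing by
        \<open>g\<close> and rescaling the constant term to 1 recovers \<open>f\<close>, so
        \<open>corner g e\<close> is \<open>c\<close>.\<close>
      define f1 where "f1 = smult (inverse (lead_coeff f)) f"
      define e where "e = g * f1"
      have ediv: "e div g = f1" using g0 by (simp add: e_def)
      have f10: "poly f1 0 \<noteq> 0" using f0 fn by (simp add: f1_def)
      have "smult (inverse (poly f1 0)) f1 = f" using fn f0 by (simp add: f1_def)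
      then have corner: "corner g e = c" by (simp add: corner_def ediv f_def)
      have lce: "lead_coeff e = 1" using lc fn by (simp add: e_def f1_def lead_coeff_mult)
      have ge: "g dvd e" by (simp add: e_def)
      have cA1: "c dvd A1$a$b" if "\<And>a b. a \<in> set js \<Longrightarrow> b \<in> set js \<Longrightarrow> c dvd A$a$b" "a \<in> set js" "b \<in> set js" for c a b
        unfolding A1_def using that by (intro dvd_mult_nth[OF P P])
      have "e dvd A1$a$b" if "a \<in> set js1" "b \<in> set js1" for a b
      proof -
        have "f dvd (mstar P ** B ** P)$a$b" using Pjl(5) that by (simp add: f_def)
        then have "f1 dvd (mstar P ** B ** P)$a$b" using fn by (simp add: f1_def smult_dvd_iff)
        then show ?thesis using that js js0 by (simp add: A1B e_def mult_dvd_mono)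
      qed
      then have eds: "\<forall>d\<in>set ds. e dvd d" using ds(5) by blast
      then have m1: "sorted_wrt (dvd) (g # e # ds)" using ds(2) ge by (auto intro: dvd_trans)
      have m2: "admissible (g # e # ds)" using ds(3) gs ge f10 by (simp add: ediv)
      have m3: "\<forall>d\<in>set (g # e # ds). c dvd d" if "\<forall>a\<in>set js. \<forall>b\<in>set js. c dvd A$a$b" for c
      proof -
        have "c dvd A1$j$l" using cA1[of c j l] that jl by blast
        then have "c dvd g" using rowj[of l] jl by simp
        then show ?thesis using ge eds by (auto intro: dvd_trans)
      qed
      have m4: "(mstar (P ** Q) ** A ** (P ** Q))$a$b = normal_form js (g # e # ds) a b" if "a \<in> set js" "b \<in> set js" for a b
      proof (cases "a \<in> set js1 \<and> b \<in> set js1")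
        case False
        then have "(mstar Q ** A1 ** Q)$a$b = A1$a$b" using sep_mult_nth[OF \<open>sep (set js1) A1\<close> Q Q] by blast
        then show ?thesis using False that rowj rowl col gs js js0 set
          by (auto simp: A1_def congruence_comp corner)
      next
        case True
        then have "a \<noteq> j" "a \<noteq> l" "b \<noteq> j" "b \<noteq> l" using set by auto
        then show ?thesis using ds(6) True js js0 gs by (simp add: A1_def congruence_comp)
      qed
      have m5: "P ** Q \<in> GLJ (set js)" using P GLJ_mono[OF Q, of "set js"] js js0 by (intro GLJ_mult) auto
      have m6: "length (g # e # ds) = length js" "\<forall>d\<in>set (g # e # ds). d = 0 \<or> lead_coeff d = 1"
        using ds(1,4) js js0 lc lce by simp_all
      show ?thesis using m1 m2 m3 m4 m6
        by (intro bexI[OF _ m5] exI[of _ "g # e # ds"]) blast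
    qed
  qed
qed

end

section \<open>Uniqueness of the invariant factors\<close>

lemma linear_power_dvd_mult:
  fixes p q :: "'a::field poly"
  assumes "[:-c, 1:] ^ m dvd p * q" "poly p c \<noteq> 0"
  shows "[:-c, 1:] ^ m dvd q"
proof (cases "q = 0")
  case False
  have p: "p \<noteq> 0" using assms(2) by auto
  have "order c p = 0" using assms(2) by (simp add: order_root)
  then have "order c (p * q) = order c q" using False p by (simp add: order_mult)
  then show ?thesis using assms(1) False p by (simp add: order_divides)
qed simp

lemma diagonal_form_nth:
  assumes "distinct js" "length ds = length js" "i < length js" "k < length js"
  shows "diagonal_form js ds (js ! i) (js ! k) = (if i = k then ds ! i else 0)"
  using assms
proof (induction js arbitrary: ds i k)
  case (Cons j js)
  then obtain d ds' where ds: "ds = d # ds'" by (cases ds) auto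
  show ?case using Cons.prems Cons.IH[of ds'] unfolding ds
    by (cases i; cases k) (auto simp: nth_eq_iff_index_eq)
qed simp

text \<open>Frobenius-Koenig: by the pigeonhole principle every permutation sends some row in
  \<open>R\<close> to a column in \<open>C\<close>, so each term of the determinant vanishes at
  \<open>c\<close>.\<close>

lemma poly_det_eq_0:
  fixes P :: "'a::comm_ring_1 poly^'n^'n"
  assumes "\<And>a b. a \<in> R \<Longrightarrow> b \<in> C \<Longrightarrow> poly (P$a$b) c = 0" "card R + card C > CARD('n)"
  shows "poly (det P) c = 0"
proof -
  have "(\<Prod>i\<in>UNIV. poly (P$i$p i) c) = 0" if p: "p permutes UNIV" for p
  proof -
    have "card (p ` R) = card R" using permutes_inj_on[OF p] by (rule card_image)
    moreover have "card (p ` R \<union> C) \<le> CARD('n)" by (rule card_mono) auto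
    moreover have "card (p ` R) + card C = card (p ` R \<union> C) + card (p ` R \<inter> C)"
      by (rule card_Un_Int) auto
    ultimately have "p ` R \<inter> C \<noteq> {}" using assms(2) by auto
    then obtain a where "a \<in> R" "p a \<in> C" by blast
    then show ?thesis using assms(1) by (intro prod_zero) auto
  qed
  then show ?thesis by (simp add: det_def poly_sum poly_prod)
qed

text \<open>Otherwise the power divides the factors of \<open>ds'\<close> from k on but none of
  those of \<open>ds\<close> up to k. Comparing entries, \<open>P\<close> vanishes at
  \<open>c\<close> on a block of n - k rows and k + 1 columns, too large for an invertible
  matrix.\<close>

lemma diagonal_dvd:
  fixes P Q :: "'a::field poly^'n^'n"
  assumes js: "distinct js" "set js = UNIV" and len: "length ds = length js" "length ds' = length js"
    and chain: "sorted_wrt (dvd) ds" "sorted_wrt (dvd) ds'" and P: "invertible P"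
    and eq: "P ** (\<chi> a b. diagonal_form js ds a b) = (\<chi> a b. diagonal_form js ds' a b) ** Q"
    and k: "k < length js" and dvd: "[:-c, 1:] ^ m dvd ds' ! k"
  shows "[:-c, 1:] ^ m dvd ds ! k"
proof (rule ccontr)
  assume n: "\<not> ?thesis"
  have bij: "bij_betw ((!) js) {..<length js} UNIV" using bij_betw_nth[OF js(1) refl js(2)[symmetric]] .
  have "poly (P$(js!i)$(js!j)) c = 0" if i: "k \<le> i" "i < length js" and j: "j \<le> k" for i j
  proof (rule ccontr)
    assume nz: "poly (P$(js!i)$(js!j)) c \<noteq> 0"
    have "(P ** (\<chi> a b. diagonal_form js ds a b))$(js!i)$(js!j) = (\<Sum>l<length js. P$(js!i)$(js!l) * diagonal_form js ds (js!l) (js!j))"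
      by (simp add: matrix_matrix_mult_def sum.reindex_bij_betw[OF bij, symmetric])
    also have "\<dots> = P$(js!i)$(js!j) * ds!j"
      using j k by (simp add: diagonal_form_nth js len if_distrib[of "\<lambda>x. _ * x"] cong: if_cong)
    finally have 1: "(P ** (\<chi> a b. diagonal_form js ds a b))$(js!i)$(js!j) = P$(js!i)$(js!j) * ds!j" .
    have "((\<chi> a b. diagonal_form js ds' a b) ** Q)$(js!i)$(js!j) = (\<Sum>l<length js. diagonal_form js ds' (js!i) (js!l) * Q$(js!l)$(js!j))"
      by (simp add: matrix_matrix_mult_def sum.reindex_bij_betw[OF bij, symmetric])
    also have "\<dots> = ds'!i * Q$(js!i)$(js!j)"
      using i by (simp add: diagonal_form_nth js len if_distrib[of "\<lambda>x. x * _"] cong: if_cong)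
    finally have "P$(js!i)$(js!j) * ds!j = ds'!i * Q$(js!i)$(js!j)" using 1 eq by simp
    moreover have "ds' ! k dvd ds' ! i"
      using chain(2) i len by (cases "i = k") (auto simp: sorted_wrt_iff_nth_less)
    ultimately have "[:-c, 1:] ^ m dvd P$(js!i)$(js!j) * ds!j" using dvd by (metis dvd_mult2 dvd_trans)
    then have "[:-c, 1:] ^ m dvd ds!j" using nz by (rule linear_power_dvd_mult)
    moreover have "ds ! j dvd ds ! k"
      using chain(1) j k len by (cases "j = k") (auto simp: sorted_wrt_iff_nth_less)
    ultimately show False using n dvd_trans by blast
  qed
  then have "poly (P$a$b) c = 0" if "a \<in> (!) js ` {k..<length js}" "b \<in> (!) js ` {..k}" for a b
    using that by auto
  moreover have "card ((!) js ` {k..<length js}) = length js - k" "card ((!) js ` {..k}) = Suc k"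
    using bij k by (subst card_image; auto simp: bij_betw_def intro: inj_on_subset)+
  moreover have "CARD('n) = length js" using bij_betw_same_card[OF bij] by simp
  ultimately have "poly (det P) c = 0" using k
    by (intro poly_det_eq_0[where R = "(!) js ` {k..<length js}" and C = "(!) js ` {..k}"]) auto
  moreover obtain P' where "P ** P' = mat 1" using P by (auto simp: invertible_def)
  then have "det P * det P' = 1" by (metis det_I det_mul)
  then have "poly (det P * det P') c = 1" by simp
  ultimately show False by simp
qed

section \<open>Equivalence and congruence as equivalence relations\<close>

lemma mat_equivalent_trans: "mat_equivalent A B \<Longrightarrow> mat_equivalent B C \<Longrightarrow> mat_equivalent A C"
proof -
  assume "mat_equivalent A B" "mat_equivalent B C"
  then obtain S T S' T' where "invertible S" "invertible T" "B = S ** A ** T"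
    "invertible S'" "invertible T'" "C = S' ** B ** T'" by (auto simp: mat_equivalent_def)
  then have "invertible (S' ** S)" "invertible (T ** T')" "C = (S' ** S) ** A ** (T ** T')"
    by (auto simp: invertible_matrix_mult matrix_mul_assoc)
  then show ?thesis unfolding mat_equivalent_def by blast
qed

lemma invertible_inverse:
  assumes "invertible (S :: 'a::comm_ring_1^'n^'n)"
  obtains S' where "S ** S' = mat 1" "S' ** S = mat 1" "invertible S'"
  using assms unfolding invertible_def by blast

lemma mat_equivalent_sym: "mat_equivalent A B \<Longrightarrow> mat_equivalent B A"
proof -
  assume "mat_equivalent A B"
  then obtain S T where ST: "invertible S" "invertible T" "B = S ** A ** T" by (auto simp: mat_equivalent_def)
  obtain S' where S': "S ** S' = mat 1" "S' ** S = mat 1" "invertible S'" using invertible_inverse[OF ST(1)] .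
  obtain T' where T': "T ** T' = mat 1" "T' ** T = mat 1" "invertible T'" using invertible_inverse[OF ST(2)] .
  have "S' ** B ** T' = (S' ** S) ** A ** (T ** T')" by (simp add: ST(3) matrix_mul_assoc)
  then have "A = S' ** B ** T'" by (simp add: S' T' matrix_mul_lid matrix_mul_rid)
  then show ?thesis using S' T' unfolding mat_equivalent_def by blast
qed

lemma invertible_mstar: "invertible S \<Longrightarrow> invertible (mstar S)"
  using GLJ_mstar[of S UNIV] by (simp add: GLJ_def)

lemma mat_congruent_equivalent: "mat_congruent A B \<Longrightarrow> mat_equivalent A B"
  unfolding mat_congruent_def mat_equivalent_def using invertible_mstar by blast

lemma mat_congruent_trans: "mat_congruent A B \<Longrightarrow> mat_congruent B C \<Longrightarrow> mat_congruent A C"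
proof -
  assume "mat_congruent A B" "mat_congruent B C"
  then obtain S T where "invertible S" "B = mstar S ** A ** S" "invertible T" "C = mstar T ** B ** T"
    unfolding mat_congruent_def by blast
  then have "invertible (S ** T)" "C = mstar (S ** T) ** A ** (S ** T)"
    by (simp_all only: invertible_matrix_mult congruence_comp)
  then show ?thesis unfolding mat_congruent_def by blast
qed

lemma mat_congruent_sym: "mat_congruent A B \<Longrightarrow> mat_congruent B A"
proof -
  assume "mat_congruent A B"
  then obtain S where S: "invertible S" "B = mstar S ** A ** S" by (auto simp: mat_congruent_def)
  obtain S' where S': "S ** S' = mat 1" "S' ** S = mat 1" "invertible S'" using invertible_inverse[OF S(1)] .
  have "mstar S' ** B ** S' = A" by (simp add: S(2) congruence_comp S'(1) matrix_mul_lid matrix_mul_rid)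
  then show ?thesis using S' unfolding mat_congruent_def by metis
qed

text \<open>The block d (t, 1; -1, c) has entries with gcd d and determinant d d f, so it is
  equivalent to diag(d, d f), and d f is \<open>e\<close> up to a constant. Thus \<open>ds\<close>
  consists of the invariant factors.\<close>

lemma normal_form_equivalent_diagonal:
  fixes D :: "'a::field poly^'n^'n"
  assumes "distinct js" "length ds = length js" "admissible ds" "sep (set js) D"
    "\<forall>a\<in>set js. \<forall>b\<in>set js. D$a$b = diagonal_form js ds a b"
  shows "\<exists>X\<in>GLJ (set js). \<exists>Y\<in>GLJ (set js). \<forall>a\<in>set js. \<forall>b\<in>set js. (mstar X ** D ** Y)$a$b = normal_form js ds a b"
  using assms
proof (induction "length js" arbitrary: js ds rule: less_induct)
  case less
  note sD = \<open>sep (set js) D\<close> and D = less.prems(5)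
  show ?case
  proof (cases js)
    case Nil
    then show ?thesis using GLJ_1 by auto
  next
    case js: (Cons j js0)
    with less.prems obtain d ds0 where ds: "ds = d # ds0" by (cases ds) auto
    show ?thesis
    proof (cases "d\<^sup>\<star> = d")
      case True
      have set: "set js0 = set js - {j}" using js less.prems(1) by auto
      have Dj: "D$a$b = (if a = b then d else 0)" if "a = j \<or> b = j" for a b
      proof (cases "a \<in> set js \<and> b \<in> set js")
        case True
        then have "D$a$b = diagonal_form js ds a b" using D by blast
        then show ?thesis using that by (simp add: js ds)
      next
        case False
        then have ne: "(a \<in> set js) \<noteq> (b \<in> set js)" using that js by auto
        then have "D$a$b = 0" using sD unfolding sep_def by blast
        then show ?thesis using ne by auto
      qed
      have s0: "sep (set js0) D"
        unfolding sep_def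
      proof (intro allI impI)
        fix a b assume ab: "(a \<in> set js0) \<noteq> (b \<in> set js0)"
        show "D$a$b = 0" using ab Dj[of a b] sD set by (cases "a = j \<or> b = j") (auto simp: sep_def)
      qed
      have D0: "\<forall>a\<in>set js0. \<forall>b\<in>set js0. D$a$b = diagonal_form js0 ds0 a b"
      proof (intro ballI)
        fix a b assume "a \<in> set js0" "b \<in> set js0"
        then show "D$a$b = diagonal_form js0 ds0 a b" using D[rule_format, of a b] less.prems(1) by (auto simp: js ds)
      qed
      obtain X Y where XY: "X \<in> GLJ (set js0)" "Y \<in> GLJ (set js0)"
        "\<forall>a\<in>set js0. \<forall>b\<in>set js0. (mstar X ** D ** Y)$a$b = normal_form js0 ds0 a b"
      proof -
        have "length js0 < length js" "distinct js0" "length ds0 = length js0" "admissible ds0"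
          using less.prems(1-3) True by (simp_all add: js ds)
        from less.hyps[OF this s0 D0] show ?thesis using that by blast
      qed
      have "(mstar X ** D ** Y)$a$b = normal_form js ds a b" if "a \<in> set js" "b \<in> set js" for a b
      proof (cases "a = j \<or> b = j")
        case j: True
        then have "\<not> (a \<in> set js0 \<and> b \<in> set js0)" using set by auto
        from sep_mult_nth[OF s0 XY(1,2) this] Dj[OF j] j True show ?thesis by (simp add: js ds)
      next
        case False
        then have "a \<in> set js0" "b \<in> set js0" using that set by auto
        then show ?thesis using XY(3) False True by (simp add: js ds)
      qed
      moreover have "X \<in> GLJ (set js)" "Y \<in> GLJ (set js)" using XY set by (auto intro: GLJ_mono)
      ultimately show ?thesis by blast
    next
      case odd: False
      then obtain e ds1 where ds0: "ds0 = e # ds1" using less.prems(3) ds by (cases ds0) auto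
      with less.prems(2) ds js obtain l js1 where js0: "js0 = l # js1" by (cases js0) auto
      have adm: "d dvd e" "poly (e div d) 0 \<noteq> 0" "admissible ds1"
        using less.prems(3) odd by (simp_all add: ds ds0)
      have d0: "d \<noteq> 0" using odd by auto
      have jl: "j \<noteq> l" and set: "set js1 = set js - {j, l}" using js js0 less.prems(1) by auto
      have Djl: "D$a$b = (if a = b then if a = j then d else e else 0)" if "a \<in> {j, l} \<or> b \<in> {j, l}" for a b
      proof (cases "a \<in> set js \<and> b \<in> set js")
        case True
        then have "D$a$b = diagonal_form js ds a b" using D by blast
        then show ?thesis using that jl by (auto simp: js js0 ds ds0)
      next
        case False
        then have ne: "(a \<in> set js) \<noteq> (b \<in> set js)" using that js js0 by auto
        then have "D$a$b = 0" using sD unfolding sep_def by blast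
        then show ?thesis using ne by auto
      qed
      have s1: "sep (set js1) D"
        unfolding sep_def
      proof (intro allI impI)
        fix a b assume ab: "(a \<in> set js1) \<noteq> (b \<in> set js1)"
        show "D$a$b = 0" using ab Djl[of a b] sD set by (cases "a \<in> {j, l} \<or> b \<in> {j, l}") (auto simp: sep_def)
      qed
      have D1: "\<forall>a\<in>set js1. \<forall>b\<in>set js1. D$a$b = diagonal_form js1 ds1 a b"
      proof (intro ballI)
        fix a b assume "a \<in> set js1" "b \<in> set js1"
        then show "D$a$b = diagonal_form js1 ds1 a b" using D[rule_format, of a b] less.prems(1)
          by (auto simp: js ds js0 ds0)
      qed
      obtain X Y where XY: "X \<in> GLJ (set js1)" "Y \<in> GLJ (set js1)"
        "\<forall>a\<in>set js1. \<forall>b\<in>set js1. (mstar X ** D ** Y)$a$b = normal_form js1 ds1 a b"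
      proof -
        have "length js1 < length js" "distinct js1" "length ds1 = length js1"
          using less.prems(1,2) by (simp_all add: js ds js0 ds0)
        from less.hyps[OF this adm(3) s1 D1] show ?thesis using that by blast
      qed
      define E where "E = mstar X ** D ** Y"
      have Ejl: "E$a$b = (if a = b then if a = j then d else e else 0)" if "a \<in> {j, l} \<or> b \<in> {j, l}" for a b
      proof -
        have "\<not> (a \<in> set js1 \<and> b \<in> set js1)" using that set by auto
        from sep_mult_nth[OF s1 XY(1,2) this] Djl[OF that] show ?thesis unfolding E_def by simp
      qed
      then have sE: "sep {j, l} E" by (auto simp: sep_def)
      define k where "k = inverse (poly (e div d) 0)"
      define c where "c = corner d e"
      have "tvar dvd smult k (e div d) - 1" using adm(2) by (simp add: tvar_dvd_iff k_def)
      then have tc: "tvar * c = smult k (e div d) - 1" by (simp add: c_def corner_def k_def)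
      have ke: "[:k:] * e = d * (tvar * c + 1)" using adm(1) by (simp add: tc)
      \<comment> \<open>An elimination run backwards from diag(d, e) to the block. The only entry
        that needs \<open>e\<close> is \<open>c * (d * tvar) - [:k:] * e = - d\<close>; products of
        elementary matrices give invertibility.\<close>
      define X0 :: "'a poly^'n^'n" where "X0 = scaling l [:-k:] ** transvection j l (c\<^sup>\<star>)"
      define Y0 :: "'a poly^'n^'n" where "Y0 = transvection j l tvar ** (scaling l (-1) **
        (transvection j l 1 ** (transvection l j (-1) ** transvection j l 1)))"
      have "[:-k:] dvd 1" using adm(2) by (simp add: k_def is_unit_const_poly_iff dvd_field_iff)
      then have X0: "X0 \<in> GLJ {j, l}" unfolding X0_def using jl
        by (intro GLJ_mult GLJ_scaling GLJ_transvection) auto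
      have Y0: "Y0 \<in> GLJ {j, l}" unfolding Y0_def using jl
        by (intro GLJ_mult GLJ_scaling GLJ_transvection) auto
      have X0jl: "X0 *v axis j 1 = axis j 1" "X0 *v axis l 1 = c\<^sup>\<star> *s axis j 1 - [:k:] *s axis l 1"
        using jl by (auto simp: X0_def matrix_vector_mul_assoc[symmetric] transvection_apply vec_eq_iff scaling_apply axis_def)
      have Y0jl: "Y0 *v axis j 1 = tvar *s axis j 1 + axis l 1" "Y0 *v axis l 1 = axis j 1"
        using jl by (auto simp: Y0_def matrix_vector_mul_assoc[symmetric] transvection_apply vec_eq_iff scaling_apply axis_def)
      have eq: "mstar (X ** X0) ** D ** (Y ** Y0) = mstar X0 ** E ** Y0"
        by (simp add: E_def mstar_mult matrix_mul_assoc)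
      have "(mstar (X ** X0) ** D ** (Y ** Y0))$a$b = normal_form js ds a b" if ab: "a \<in> set js" "b \<in> set js" for a b
      proof (cases "a \<in> {j, l} \<and> b \<in> {j, l}")
        case True
        have "c * (d * tvar) - [:k:] * e = - d" unfolding ke by (simp add: algebra_simps)
        then show ?thesis
          using True jl odd unfolding eq
          by (auto simp: mult_nth X0jl Y0jl sesq_lin Ejl js js0 ds ds0 c_def[symmetric] mult.commute simp del: mult_pCons_left mult_pCons_right)
      next
        case False
        then have "(mstar X0 ** E ** Y0)$a$b = E$a$b" using sep_mult_nth[OF sE X0 Y0] by blast
        moreover have "E$a$b = normal_form js ds a b"
        proof (cases "a \<in> {j, l} \<or> b \<in> {j, l}")
          case True
          then show ?thesis using False Ejl[OF True] odd jl by (auto simp: js js0 ds ds0)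
        next
          case no: False
          then have "a \<in> set js1" "b \<in> set js1" using ab set by auto
          then show ?thesis using XY(3) no odd by (simp add: E_def js js0 ds ds0)
        qed
        ultimately show ?thesis by (simp add: eq)
      qed
      moreover have "X ** X0 \<in> GLJ (set js)" "Y ** Y0 \<in> GLJ (set js)"
        using GLJ_mono[OF XY(1), of "set js"] GLJ_mono[OF XY(2), of "set js"] GLJ_mono[OF X0, of "set js"]
          GLJ_mono[OF Y0, of "set js"] by (auto intro!: GLJ_mult simp: js js0)
      ultimately show ?thesis by blast
    qed
  qed
qed

lemma monic_dvd_antisym:
  fixes p q :: "'a::field poly"
  assumes "p dvd q" "q dvd p" "p = 0 \<or> lead_coeff p = 1" "q = 0 \<or> lead_coeff q = 1"
  shows "p = q"
proof (cases "p = 0")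
  case False
  obtain r where r: "q = p * r" using assms(1) by (rule dvdE)
  with False assms(2) have q0: "q \<noteq> 0" "r \<noteq> 0" by auto
  have "degree q = degree p"
    using dvd_imp_degree_le[OF assms(1) q0(1)] dvd_imp_degree_le[OF assms(2) False] by simp
  then have "degree r = 0" unfolding r using False q0(2) by (simp add: degree_mult_eq)
  then obtain c where c: "r = [:c:]" by (rule degree_eq_zeroE)
  then have "c = 1" using assms(3,4) False q0(1) by (simp add: r)
  then show ?thesis by (simp add: r c)
qed (use assms in simp)

context alg_closed_char_not_2 begin

text \<open>Over an algebraically closed field the linear factors are split off one at a
  time.\<close>

lemma dvd_by_roots:
  assumes "\<And>c m. [:-c, 1:] ^ m dvd p \<Longrightarrow> [:-c, 1 :: 'a:] ^ m dvd q"
  shows "p dvd q"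
proof (cases "p = 0")
  case True
  \<comment> \<open>0 is divisible by all powers of t, among them one of degree exceeding that of
    \<open>q\<close>.\<close>
  then have "[:-0, 1:] ^ Suc (degree q) dvd q" using True by (intro assms) (simp only: dvd_0_right)
  then have "q = 0" by (metis degree_linear_power dvd_imp_degree_le not_less_eq_eq order_refl)
  then show ?thesis by simp
next
  case False
  then show ?thesis using assms
  proof (induction "degree p" arbitrary: p q rule: less_induct)
    case less
    show ?case
    proof (cases "degree p = 0")
      case True
      then have "p dvd 1" using less.prems(1) by (simp add: is_unit_iff_degree)
      then show ?thesis by (rule unit_imp_dvd)
    next
      case False
      then obtain c where "poly p c = 0" using ex_root[of p] by auto
      then obtain p1 where p1: "p = [:-c, 1:] * p1" by (metis poly_eq_0_iff_dvd dvdE)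
      then have "[:-c, 1:] ^ 1 dvd q" by (intro less.prems(2)) (simp only: power_one_right dvd_triv_left)
      then obtain q1 where q1: "q = [:-c, 1:] * q1" by (auto simp: dvd_def)
      have p10: "p1 \<noteq> 0" using less.prems(1) p1 by auto
      have "degree p = 1 + degree p1" unfolding p1 using p10 by (subst degree_mult_eq) auto
      then have "degree p1 < degree p" by simp
      moreover have "[:-b, 1:] ^ m dvd q1" if m: "[:-b, 1:] ^ m dvd p1" for b m
      proof (cases "b = c")
        case True
        have "[:-c, 1:] ^ Suc m dvd p" using m True by (simp only: p1 power_Suc mult_dvd_mono dvd_refl)
        then have "[:-c, 1:] ^ Suc m dvd q" by (rule less.prems(2))
        then show ?thesis unfolding q1 power_Suc True by (subst (asm) dvd_mult_cancel_left) auto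
      next
        case False
        have "[:-b, 1:] ^ m dvd p" using m by (simp only: p1 dvd_mult)
        then have "[:-b, 1:] ^ m dvd [:-c, 1:] * q1" unfolding q1[symmetric] by (rule less.prems(2))
        then show ?thesis by (rule linear_power_dvd_mult) (use False in simp)
      qed
      ultimately have "p1 dvd q1" using less.hyps p10 by blast
      then show ?thesis unfolding p1 q1 by (rule mult_dvd_mono[OF dvd_refl])
    qed
  qed
qed

text \<open>Equivalence is symmetric, so \<open>diagonal_dvd\<close> works in both directions;
  associated factors that are monic or 0 coincide.\<close>

lemma equivalent_diagonals:
  fixes ds ds' :: "'a poly list"
  assumes js: "distinct js" "set js = (UNIV :: 'n::finite set)" and len: "length ds = length js" "length ds' = length js"
    and chain: "sorted_wrt (dvd) ds" "sorted_wrt (dvd) ds'"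
    and monic: "\<forall>d\<in>set ds. d = 0 \<or> lead_coeff d = 1" "\<forall>d\<in>set ds'. d = 0 \<or> lead_coeff d = 1"
    and equiv: "mat_equivalent (\<chi> a b. diagonal_form js ds a b :: 'a poly^'n^'n) (\<chi> a b. diagonal_form js ds' a b)"
  shows "ds = ds'"
proof (rule nth_equalityI)
  fix k assume k: "k < length ds"
  have le: "ds' ! k dvd ds ! k"
    if "mat_equivalent D D'" "D = (\<chi> a b. diagonal_form js ds a b)" "D' = (\<chi> a b. diagonal_form js ds' a b)"
      "length ds = length js" "length ds' = length js" "sorted_wrt (dvd) ds" "sorted_wrt (dvd) ds'" "k < length js"
    for ds ds' and D D' :: "'a poly^'n^'n"
  proof -
    from that(1) obtain S T where ST: "invertible S" "invertible T" "D' = S ** D ** T"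
      unfolding mat_equivalent_def by blast
    obtain T' where T': "T ** T' = mat 1" using ST(2) by (auto simp: invertible_def)
    have "S ** D = D' ** T'"
      unfolding ST(3) using T' by (simp add: matrix_mul_assoc[symmetric] matrix_mul_rid)
    note eq = this[unfolded that(2,3)]
    show ?thesis by (rule dvd_by_roots, rule diagonal_dvd[OF js that(4-7) ST(1) eq that(8)])
  qed
  have "ds' ! k dvd ds ! k" "ds ! k dvd ds' ! k"
    using le[OF equiv refl refl len chain] le[OF mat_equivalent_sym[OF equiv] refl refl len(2,1) chain(2,1)] k len
    by auto
  moreover have "ds ! k = 0 \<or> lead_coeff (ds ! k) = 1" "ds' ! k = 0 \<or> lead_coeff (ds' ! k) = 1"
    using monic k len by auto
  ultimately show "ds ! k = ds' ! k" by (intro monic_dvd_antisym)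
qed (use len in simp)

text \<open>One list serves both relations: the diagonal form makes it an invariant of equivalence,
  the normal form makes it decide congruence.\<close>

lemma hermitian_normal_form:
  fixes A :: "'a poly^'n^'n"
  assumes A: "hermitian A" and js: "distinct js" "set js = UNIV"
  obtains ds where "length ds = length js" "sorted_wrt (dvd) ds" "\<forall>d\<in>set ds. d = 0 \<or> lead_coeff d = 1"
    "mat_congruent A (\<chi> a b. normal_form js ds a b)" "mat_equivalent A (\<chi> a b. diagonal_form js ds a b)"
proof -
  have "sep (set js) A" by (simp add: sep_def js)
  from normal_form_exists[OF js(1) A[unfolded hermitian_eherm] this] obtain P ds where
    P: "P \<in> GLJ UNIV" and ds: "length ds = length js" "sorted_wrt (dvd) ds" "admissible ds"
      "\<forall>d\<in>set ds. d = 0 \<or> lead_coeff d = 1" and normal_form: "\<And>a b. (mstar P ** A ** P)$a$b = normal_form js ds a b"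
    unfolding js(2) by auto
  let ?N = "\<chi> a b. normal_form js ds a b :: 'a poly^'n^'n" and ?D = "\<chi> a b. diagonal_form js ds a b :: 'a poly^'n^'n"
  have "?N = mstar P ** A ** P" by (simp add: vec_eq_iff normal_form)
  then have cong: "mat_congruent A ?N" using GLJ_invertible[OF P] unfolding mat_congruent_def by blast
  have "sep (set js) ?D" by (simp add: sep_def js)
  from normal_form_equivalent_diagonal[OF js(1) ds(1,3) this] obtain X Y where
    XY: "X \<in> GLJ UNIV" "Y \<in> GLJ UNIV" "\<And>a b. (mstar X ** ?D ** Y)$a$b = normal_form js ds a b"
    unfolding js(2) by auto
  have "?N = mstar X ** ?D ** Y" using XY(3) by (simp add: vec_eq_iff)
  then have "mat_equivalent ?D ?N"
    using GLJ_invertible[OF XY(2)] invertible_mstar[OF GLJ_invertible[OF XY(1)]] unfolding mat_equivalent_def by blast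
  then have "mat_equivalent A ?D"
    using mat_equivalent_trans[OF mat_congruent_equivalent[OF cong] mat_equivalent_sym] by blast
  with ds cong show ?thesis using that by blast
qed

lemma hermitian_equivalent_congruent:
  fixes A A' :: "'a poly^'n^'n"
  assumes A: "hermitian A" "hermitian A'" and equiv: "mat_equivalent A A'"
  shows "mat_congruent A A'"
proof -
  \<comment> \<open>A common enumeration of the indices, so that both matrices are compared with the
    same normal form.\<close>
  obtain js where js: "distinct js" "set js = (UNIV :: 'n set)" using finite_distinct_list[of "UNIV :: 'n set"] finite by metis
  obtain ds where ds: "length ds = length js" "sorted_wrt (dvd) ds" "\<forall>d\<in>set ds. d = 0 \<or> lead_coeff d = 1"
    "mat_congruent A (\<chi> a b. normal_form js ds a b)" "mat_equivalent A (\<chi> a b. diagonal_form js ds a b)"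
    using hermitian_normal_form[OF A(1) js] .
  obtain ds' where ds': "length ds' = length js" "sorted_wrt (dvd) ds'" "\<forall>d\<in>set ds'. d = 0 \<or> lead_coeff d = 1"
    "mat_congruent A' (\<chi> a b. normal_form js ds' a b)" "mat_equivalent A' (\<chi> a b. diagonal_form js ds' a b)"
    using hermitian_normal_form[OF A(2) js] .
  have "mat_equivalent (\<chi> a b. diagonal_form js ds a b :: 'a poly^'n^'n) (\<chi> a b. diagonal_form js ds' a b)"
    using mat_equivalent_trans[OF mat_equivalent_sym[OF ds(5)] mat_equivalent_trans[OF equiv ds'(5)]] .
  then have "ds = ds'" by (rule equivalent_diagonals[OF js ds(1) ds'(1) ds(2) ds'(2) ds(3) ds'(3)])
  with ds(4) ds'(4) show ?thesis using mat_congruent_trans mat_congruent_sym by blast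
qed

end

section \<open>From the hermitian to the skew-hermitian case\<close>

definition tvar_scaled :: "'a::comm_ring_1 poly^'n^'n \<Rightarrow> 'a poly^'n^'n" where
  "tvar_scaled A = (\<chi> i j. tvar * A$i$j)"

lemma tvar_scaled_mult: "S ** tvar_scaled A ** T = tvar_scaled (S ** A ** T)"
  by (simp add: tvar_scaled_def matrix_matrix_mult_def vec_eq_iff sum_distrib_left mult_ac)

lemma tvar_scaled_inject: "tvar_scaled A = tvar_scaled B \<longleftrightarrow> A = (B :: 'a::idom poly^'n^'n)"
  by (simp add: tvar_scaled_def vec_eq_iff)

lemma hermitian_tvar_scaled: "skew_hermitian A \<Longrightarrow> hermitian (tvar_scaled A)"
  by (simp add: hermitian_def skew_hermitian_def tvar_scaled_def mstar_def vec_eq_iff)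

theorem theorem4p5:
  fixes A A' :: "'a::field poly ^'n^'n"
  assumes "alg_closed_field TYPE('a)"
    and "(2::'a) \<noteq> 0"
    and "(hermitian A \<and> hermitian A') \<or> (skew_hermitian A \<and> skew_hermitian A')"
    and "mat_equivalent A A'"
  shows "mat_congruent A A'"
proof -
  interpret alg_closed_char_not_2 "TYPE('a)" by unfold_locales (use assms in auto)
  from assms(3) show ?thesis
  proof
    assume "hermitian A \<and> hermitian A'"
    then show ?thesis using hermitian_equivalent_congruent assms(4) by blast
  next
    assume "skew_hermitian A \<and> skew_hermitian A'"
    moreover have "mat_equivalent (tvar_scaled A) (tvar_scaled A')"
      using assms(4) unfolding mat_equivalent_def by (metis tvar_scaled_mult)
    ultimately have "mat_congruent (tvar_scaled A) (tvar_scaled A')"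
      using hermitian_equivalent_congruent hermitian_tvar_scaled by blast
    \<comment> \<open>Scaling by t commutes with matrix products and is injective, so the same
      transformation matrix works for \<open>A\<close> and \<open>A'\<close>.\<close>
    then show ?thesis unfolding mat_congruent_def tvar_scaled_mult tvar_scaled_inject .
  qed
qed

end
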